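(* Assume $F$ and the stochastic gradients satisfy the $G$-Lipschitz assumption. Let $(\gamma_t)$ be a decreasing step size sequence with at most polynomial decay with decay constant $0<\beta\le 1$. Let $T\ge 4$. Let $y_1,\dots,y_T$ be the iterates of SGD with step sizes $\gamma_t$, let $\alpha_t:=2^{-i}\gamma_t$ for $T_i<t\le T_{i+1}$, $0\le i\le k$, and let $x_1,\dots,x_T$ be the iterates of SGD with step sizes $\alpha_t$. Let $q^{(0)}$ be an arbitrary fixed probability distribution over $\{\lceil T/4\rceil,\dots,T_1\}$ and let $\delta\in(0,1)$. Then with probability at least $1-\frac{\delta}{2}$, $$F(x_T)\le \gamma_T\, G^2\left(120\log\tfrac1\delta+400\right)\left(\frac{1}{\beta^2}+\frac{1}{\beta^4}\right)+\sum_{s=\lceil T/4\rceil}^{T_1}q^{(0)}(s)F(y_s).$$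
   Context: Setting. $\mathcal{W}\subset\mathbb{R}^d$ is a closed convex set, $F:\mathbb{R}^d\to\mathbb{R}$ is a convex function, and $x^*\in\mathcal{W}$ is a global minimizer of $F$. $\|\cdot\|$ is the Euclidean norm, $\partial F(x)$ the subdifferential, and $\Pi_{\mathcal{W}}$ the Euclidean projection onto $\mathcal{W}$. At each time step $t$ one has access to a random map $\hat g_t$ with $\mathbb{E}[\hat g_t(x)]=g_t(x)\in\partial F(x)$ for every $x\in\mathcal{W}$; these estimates (and the noises $\hat g_t-g_t$) are independent across $t$. SGD with step sizes $\alpha_t\ge 0$: starting from a point $x_1\in\mathcal{W}$, set $x_{t+1}=\Pi_{\mathcal{W}}(x_t-\alpha_t\hat g_t(x_t))$. Both runs above start at the same point ($x_1=y_1$) and use the same realizations of the random maps $\hat g_t$ (so $x_t=y_t$ for $t\le T_1$). $G$-Lipschitz assumption: $\|g(x)\|\le G$ for every $x\in\mathcal{W}$ and every $g(x)\in\partial F(x)$, and $\|\hat g_t(x)\|\le G$ almost surely for every $x\in\mathcal{W}$ and every $t$. A step size sequence $(\gamma_t)_{t\ge1}$ of nonnegative reals is decreasing if $\gamma_{t+1}\le\gamma_t$ for all $t\geq 1$, and has at most polynomial decay with decay constant $0<\beta\le1$ if $\gamma_{2t}\ge\beta\gamma_t$ for every $t\ge1$. Times $T_i$: $k:=\inf\{i: T\cdot 2^{-i}\le 1\}$, $T_i:=T-\lceil T\cdot 2^{-i}\rceil$ for $0\le i\le k$, and $T_{k+1}:=T$. *)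

theory Defs
  imports "HOL-Probability.Probability"
begin

definition subdifferential :: "('a::real_inner \<Rightarrow> real) \<Rightarrow> 'a \<Rightarrow> 'a set"
  where "subdifferential F x = {v. \<forall>y. F x + v \<bullet> (y - x) \<le> F y}"

(* SGD for a fixed realization h t of the gradient oracles.  Iterates are indexed
   from 1; index 0 is a dummy that is never used. *)
fun sgd :: "'a::euclidean_space set \<Rightarrow> (nat \<Rightarrow> real) \<Rightarrow> (nat \<Rightarrow> 'a \<Rightarrow> 'a) \<Rightarrow> 'a \<Rightarrow> nat \<Rightarrow> 'a"
  where
    "sgd W a h x1 0 = x1"
  | "sgd W a h x1 (Suc 0) = x1"
  | "sgd W a h x1 (Suc (Suc n)) =
       closest_point W (sgd W a h x1 (Suc n)
         - a (Suc n) *\<^sub>R h (Suc n) (sgd W a h x1 (Suc n)))"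

(* Random maps on W are independent if their randomness comes from independent
   sigma-algebras A t, each h t being jointly measurable in (\<omega>, x) with respect to A t.
   Independence of the families of point evaluations h t _ x alone would not do: it
   says nothing about h t evaluated at a random point that depends on earlier maps
   (consider maps that are zero except at a single random point with continuous
   distribution). *)
definition indep_random_maps ::
    "'w measure \<Rightarrow> 'a::euclidean_space set \<Rightarrow> (nat \<Rightarrow> 'w \<Rightarrow> 'a \<Rightarrow> 'a) \<Rightarrow> nat set \<Rightarrow> bool"
  where "indep_random_maps M W h I \<longleftrightarrow>
    (\<exists>A. (\<forall>t\<in>I. subalgebra M (A t) \<and>
            (\<lambda>(\<omega>, x). h t \<omega> x) \<in> borel_measurable (A t \<Otimes>\<^sub>M restrict_space borel W)) \<and>
         prob_space.indep_sets M (\<lambda>t. sets (A t)) I)"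

definition stochastic_subgradient_oracle ::
    "'w measure \<Rightarrow> 'a::euclidean_space set \<Rightarrow> ('a \<Rightarrow> real) \<Rightarrow>
     (nat \<Rightarrow> 'a \<Rightarrow> 'a) \<Rightarrow> (nat \<Rightarrow> 'w \<Rightarrow> 'a \<Rightarrow> 'a) \<Rightarrow> bool"
  where "stochastic_subgradient_oracle M W F g h \<longleftrightarrow>
    indep_random_maps M W h {1..} \<and>
    (\<forall>t\<ge>1. \<forall>x\<in>W. integrable M (\<lambda>\<omega>. h t \<omega> x) \<and>
                   (\<integral>\<omega>. h t \<omega> x \<partial>M) = g t x \<and>
                   g t x \<in> subdifferential F x)"

definition G_Lipschitz ::
    "'w measure \<Rightarrow> 'a::euclidean_space set \<Rightarrow> ('a \<Rightarrow> real) \<Rightarrow>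
     (nat \<Rightarrow> 'w \<Rightarrow> 'a \<Rightarrow> 'a) \<Rightarrow> real \<Rightarrow> bool"
  where "G_Lipschitz M W F h G \<longleftrightarrow>
    (\<forall>x\<in>W. \<forall>v\<in>subdifferential F x. norm v \<le> G) \<and>
    (\<forall>t\<ge>1. \<forall>x\<in>W. AE \<omega> in M. norm (h t \<omega> x) \<le> G)"

definition decreasing_steps :: "(nat \<Rightarrow> real) \<Rightarrow> bool"
  where "decreasing_steps c \<longleftrightarrow> (\<forall>t\<ge>1. 0 \<le> c t \<and> c (t + 1) \<le> c t)"

definition poly_decay :: "real \<Rightarrow> (nat \<Rightarrow> real) \<Rightarrow> bool"
  where "poly_decay b c \<longleftrightarrow> 0 < b \<and> b \<le> 1 \<and> (\<forall>t\<ge>1. b * c t \<le> c (2 * t))"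

definition last_phase :: "nat \<Rightarrow> nat"
  where "last_phase T = (LEAST i. real T / 2 ^ i \<le> 1)"

(* The natural-number subtraction does not truncate, as T / 2 ^ i \<le> T. *)
definition phase_time :: "nat \<Rightarrow> nat \<Rightarrow> nat"
  where "phase_time T i =
    (if i \<le> last_phase T then T - nat \<lceil>real T / 2 ^ i\<rceil> else T)"

end

theory Submission imports Defs
begin

text \<open>
  Comparing SGD with one of its own iterates \<open>x\<^sub>s\<close> in place of a minimizer bounds
  the weighted gaps \<open>F x\<^sub>t - F x\<^sub>s\<close> for \<open>t \<ge> s\<close>. Averaging these comparisons
  over \<open>s\<close> with suitable nonnegative weights \<open>p\<close> cancels every function value except those wanted
  in the end: lemma \<open>last_iterate_identity\<close> gives \<open>p\<close> in closed form such that the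
  combination equals \<open>F x\<^sub>T - (\<Sum>s. q s * F x\<^sub>s)\<close>. All phases are thus treated at once,
  without a separate comparison, or a separate failure probability, for each of them.

  The price is the error \<open>\<Sum>t. \<alpha>\<^sub>t\<^sup>2 G\<^sup>2 P\<^sub>t\<close>, where \<open>P\<^sub>t\<close> is the sum of \<open>p\<close> up to
  \<open>t\<close> and is at most twice the inverse of the remaining sum of step sizes. Halving \<open>\<alpha>\<close> whenever the remaining
  time halves makes \<open>\<alpha>\<^sub>t\<close> comparable to \<open>\<gamma>\<^sub>T (T - t) / T\<close>. The remaining sum is then of
  order \<open>\<gamma>\<^sub>T (T - t)\<^sup>2 / T\<close>, so every term of the error is of order \<open>\<gamma>\<^sub>T G\<^sup>2 / T\<close> and their
  sum is of order \<open>\<gamma>\<^sub>T G\<^sup>2\<close> (lemma \<open>linear_decay_reference_mass\<close>). The factor \<open>1 / \<beta>\<^sup>4\<close>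
  appears because \<open>\<gamma>\<close> may be larger than \<open>\<gamma>\<^sub>T\<close> by \<open>1 / \<beta>\<^sup>2\<close> on the last three quarters of the time
  span, and it enters squared.

  The noise is the difficulty: at time \<open>t\<close> it is the inner product of the gradient error with
  \<open>d = (\<Sum>s\<le>t. p s (x\<^sub>t - x\<^sub>s))\<close>, and these distances have no useful a priori
  bound. By the Cauchy-Schwarz inequality, however, \<open>d\<close> is controlled by the potential
  \<open>V = (\<Sum>s\<le>t. p s |x\<^sub>t - x\<^sub>s|\<^sup>2)\<close>, the very quantity that telescopes in the
  analysis of SGD. If \<open>V\<close> is multiplied by weights \<open>w\<^sub>t\<close> that decrease slowly, from \<open>1\<close> to
  \<open>1/2\<close>, then the decrease of \<open>w V\<close> pays for the exponential moment of the noise, which is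
  bounded by Hoeffding's lemma. The exponential of the total weighted gap plus the potential
  therefore has expectation at most \<open>1\<close> (lemma \<open>potential_exp_moment\<close>), and a Chernoff
  bound finishes the argument.

  The oracle is evaluated at a random point that depends on earlier noise. Lemma
  \<open>nn_integral_indep_subalgebras\<close> handles this: since the randomness at time \<open>t\<close> is independent of
  the past, the past may be frozen while one integrates over the new noise.
\<close>

section \<open>Weights that turn SGD regrets into a bound on the last iterate\<close>

definition tail_sum :: "(nat \<Rightarrow> real) \<Rightarrow> nat \<Rightarrow> nat \<Rightarrow> real"
  where "tail_sum a T n = (\<Sum>r\<in>{n<..T}. a r)"

text \<open>
  If \<open>a t\<close> is the weight of step \<open>t\<close> and each of the iterates \<open>s \<le> t\<close> serves as
  a reference point with weight \<open>p s\<close>, the coefficient of \<open>F x\<^sub>t\<close> in the combination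
  of all gaps is \<open>a t * P t - p t * (\<Sum>r\<ge>t. a r)\<close>, where \<open>P\<close> is the cumulative sum of \<open>p\<close>.
  Writing \<open>R\<close> for the tail sum, this is \<open>P (t-1) * R (t-1) - P t * R t\<close>, which is \<open>- q t\<close>
  precisely if \<open>P t * R t\<close> is the cumulative sum of \<open>q\<close>. At \<open>t = T\<close> the tail sum vanishes;
  taking the minimum with \<open>T - 1\<close> lets the mass stay constant in the last step, so that \<open>x\<^sub>T\<close>
  itself is not a reference point.
\<close>

definition reference_mass :: "(nat \<Rightarrow> real) \<Rightarrow> (nat \<Rightarrow> real) \<Rightarrow> nat \<Rightarrow> nat \<Rightarrow> real"
  where "reference_mass a q T n =
    (let m = min n (T - 1) in (\<Sum>s=1..m. q s) / tail_sum a T m)"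

definition reference_weight :: "(nat \<Rightarrow> real) \<Rightarrow> (nat \<Rightarrow> real) \<Rightarrow> nat \<Rightarrow> nat \<Rightarrow> real"
  where "reference_weight a q T n = reference_mass a q T n - reference_mass a q T (n - 1)"

lemma tail_sum_step:
  assumes "n < T"
  shows "tail_sum a T n = a (Suc n) + tail_sum a T (Suc n)"
proof -
  have "{n<..T} = insert (Suc n) {Suc n<..T}" using assms by auto
  then show ?thesis by (simp add: tail_sum_def)
qed

lemma tail_sum_pos:
  assumes "\<And>r. r \<in> {1..T} \<Longrightarrow> 0 < a r" and "n < T"
  shows "0 < tail_sum a T n"
  unfolding tail_sum_def using assms by (intro sum_pos) auto

lemma tail_sum_antimono:
  assumes "\<And>r. r \<in> {1..T} \<Longrightarrow> 0 < a r" and "m \<le> n"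
  shows "tail_sum a T n \<le> tail_sum a T m"
  unfolding tail_sum_def using assms by (intro sum_mono2) (auto intro: less_imp_le)

text \<open>
  The numerator grows and the denominator shrinks with time. Hence the weights of the
  reference points are nonnegative, as the subgradient and Cauchy-Schwarz inequalities require later.
\<close>

lemma reference_mass_mono:
  assumes "\<And>r. r \<in> {1..T} \<Longrightarrow> 0 < a r" "\<And>s. 0 \<le> q s" "0 < T" "m \<le> n"
  shows "reference_mass a q T m \<le> reference_mass a q T n"
  unfolding reference_mass_def Let_def
proof (rule frac_le)
  show "0 \<le> (\<Sum>s = 1..min n (T - 1). q s)" using assms by (intro sum_nonneg) auto
  show "(\<Sum>s = 1..min m (T - 1). q s) \<le> (\<Sum>s = 1..min n (T - 1). q s)"
    using assms by (intro sum_mono2) auto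
  show "0 < tail_sum a T (min n (T - 1))"
    using assms by (intro tail_sum_pos) auto
  show "tail_sum a T (min n (T - 1)) \<le> tail_sum a T (min m (T - 1))"
    using assms by (intro tail_sum_antimono) auto
qed

lemma reference_weight_nonneg:
  assumes "\<And>r. r \<in> {1..T} \<Longrightarrow> 0 < a r" "\<And>s. 0 \<le> q s" "0 < T"
  shows "0 \<le> reference_weight a q T n"
  unfolding reference_weight_def
  using reference_mass_mono[of T a q "n - 1" n] assms by auto

lemma sum_reference_weight: "(\<Sum>s=1..n. reference_weight a q T s) = reference_mass a q T n"
  by (induction n) (auto simp: reference_weight_def reference_mass_def)

lemma reference_mass_tail_sum:
  assumes "\<And>r. r \<in> {1..T} \<Longrightarrow> 0 < a r" "n < T"
  shows "reference_mass a q T n * tail_sum a T n = (\<Sum>s=1..n. q s)"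
proof -
  have "tail_sum a T n > 0" using assms by (rule tail_sum_pos)
  moreover have "min n (T - 1) = n" using assms by auto
  ultimately show ?thesis by (simp add: reference_mass_def)
qed

lemma reference_mass_last:
  assumes "0 < T"
  shows "reference_mass a q T T = reference_mass a q T (T - 1)"
  using assms by (simp add: reference_mass_def)

text \<open>
  Up to time \<open>n\<close> the reference values are not yet compensated by later function values: each of
  them is still missing the step weights after \<open>n\<close>, which add up to the tail sum.
\<close>

lemma last_iterate_partial_sums:
  fixes a q F :: "nat \<Rightarrow> real"
  assumes a: "\<And>r. r \<in> {1..T} \<Longrightarrow> 0 < a r" and "n < T"
  defines "P \<equiv> reference_mass a q T" and "p \<equiv> reference_weight a q T"
  shows "(\<Sum>t=1..n. a t * (P t * F t - (\<Sum>s=1..t. p s * F s))) =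
         tail_sum a T n * (\<Sum>s=1..n. p s * F s) - (\<Sum>s=1..n. q s * F s)"
  using \<open>n < T\<close>
proof (induction n)
  case (Suc n)
  let ?R = "tail_sum a T" and ?C = "\<lambda>n. \<Sum>s=1..n. p s * F s"
  have R: "?R n = a (Suc n) + ?R (Suc n)" using Suc.prems by (intro tail_sum_step) auto
  have p: "p (Suc n) = P (Suc n) - P n" by (simp add: p_def P_def reference_weight_def)
  have 1: "P n * ?R n = (\<Sum>s=1..n. q s)" "P (Suc n) * ?R (Suc n) = (\<Sum>s=1..Suc n. q s)"
    unfolding P_def using Suc.prems a
    by (intro reference_mass_tail_sum; simp)+
  have key: "a (Suc n) * P (Suc n) - ?R n * p (Suc n) = - q (Suc n)"
  proof -
    have "a (Suc n) * P (Suc n) - ?R n * p (Suc n) = P n * ?R n - P (Suc n) * ?R (Suc n)"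
      unfolding p R by (simp add: algebra_simps)
    then show ?thesis unfolding 1 by simp
  qed
  have "(\<Sum>t=1..Suc n. a t * (P t * F t - ?C t)) =
        ?R n * ?C n - (\<Sum>s=1..n. q s * F s) + a (Suc n) * (P (Suc n) * F (Suc n) - ?C (Suc n))"
    using Suc by simp
  also have "?R n * ?C n = (a (Suc n) + ?R (Suc n)) * ?C (Suc n) - ?R n * p (Suc n) * F (Suc n)"
    unfolding R[symmetric] by (simp add: algebra_simps)
  also have "\<dots> - (\<Sum>s=1..n. q s * F s) + a (Suc n) * (P (Suc n) * F (Suc n) - ?C (Suc n)) =
      ?R (Suc n) * ?C (Suc n) - (\<Sum>s=1..n. q s * F s)
      + (a (Suc n) * P (Suc n) - ?R n * p (Suc n)) * F (Suc n)"
    by (simp only: algebra_simps)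
  also have "\<dots> = ?R (Suc n) * ?C (Suc n) - (\<Sum>s=1..Suc n. q s * F s)"
    unfolding key by simp
  finally show ?case .
qed simp

text \<open>
  In the last step \<open>P T * a T = 1\<close> and the weight of \<open>x\<^sub>T\<close> as a reference point is \<open>0\<close>, so
  the uncompensated reference values of the partial sums cancel and only \<open>F T\<close> is left over.
\<close>

lemma last_iterate_identity:
  fixes a q F :: "nat \<Rightarrow> real"
  assumes a: "\<And>r. r \<in> {1..T} \<Longrightarrow> 0 < a r" and "0 < T" and q: "(\<Sum>s=1..<T. q s) = 1"
  defines "P \<equiv> reference_mass a q T" and "p \<equiv> reference_weight a q T"
  shows "(\<Sum>t=1..T. a t * (P t * F t - (\<Sum>s=1..t. p s * F s))) = F T - (\<Sum>s=1..<T. q s * F s)"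
proof -
  obtain n where T: "T = Suc n" using \<open>0 < T\<close> gr0_conv_Suc by auto
  let ?R = "tail_sum a T" and ?C = "\<lambda>n. \<Sum>s=1..n. p s * F s"
  have n: "n < T" and iv: "{1..<T} = {1..n}" using T by auto
  have "{n<..T} = {T}" using T by auto
  then have R: "?R n = a T" by (simp add: tail_sum_def)
  have pT: "p T = 0" unfolding p_def reference_weight_def using reference_mass_last[OF \<open>0 < T\<close>] by simp
  have "P n * ?R n = (\<Sum>s=1..n. q s)"
    unfolding P_def using a n by (intro reference_mass_tail_sum) auto
  moreover have "P T = P n"
    unfolding P_def using reference_mass_last[OF \<open>0 < T\<close>] T by simp
  ultimately have PT: "a T * P T = 1"
    using q R iv by (simp add: mult.commute)
  have "(\<Sum>t=1..T. a t * (P t * F t - ?C t)) =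
        (\<Sum>t=1..n. a t * (P t * F t - ?C t)) + a T * (P T * F T - ?C T)"
    by (simp add: T)
  also have "(\<Sum>t=1..n. a t * (P t * F t - ?C t)) = ?R n * ?C n - (\<Sum>s=1..n. q s * F s)"
    unfolding P_def p_def by (rule last_iterate_partial_sums[OF a n])
  also have "?C T = ?C n" using pT by (simp add: T)
  also have "?R n * ?C n - (\<Sum>s=1..n. q s * F s) + a T * (P T * F T - ?C n)
      = (a T * P T) * F T - (\<Sum>s=1..n. q s * F s)"
    unfolding R by (simp add: algebra_simps)
  finally show ?thesis using PT iv by simp
qed

section \<open>The phased step sizes decay linearly\<close>

lemma last_phase_bounds:
  assumes "T \<ge> 2"
  shows "0 < last_phase T" and "real T / 2 ^ last_phase T \<le> 1"
    and "1 < real T / 2 ^ (last_phase T - 1)"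
proof -
  obtain n where "real T < 2 ^ n" using real_arch_pow[of 2 "real T"] by auto
  then have ex: "real T / 2 ^ n \<le> 1" by simp
  show le: "real T / 2 ^ last_phase T \<le> 1"
    unfolding last_phase_def using ex by (rule LeastI)
  show pos: "0 < last_phase T"
    using le assms by (cases "last_phase T = 0") auto
  show "1 < real T / 2 ^ (last_phase T - 1)"
    using not_less_Least[of "last_phase T - 1" "\<lambda>i. real T / 2 ^ i \<le> 1"] pos
    unfolding last_phase_def[symmetric] by auto
qed

text \<open>
  The phases are dyadic in the remaining time: \<open>t\<close> lies in phase \<open>i\<close> when the remaining
  fraction of time \<open>(T - t) / T\<close> lies in \<open>[1 / 2^(i+1), 1 / 2^i)\<close>. Thus the factor \<open>1 / 2^i\<close>
  is the remaining fraction up to a factor of two.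
\<close>

lemma phase_of_time:
  assumes "1 \<le> t" "t < T"
  obtains i where "i \<le> last_phase T" "phase_time T i < t" "t \<le> phase_time T (i + 1)"
    "real (T - t) / T < 1 / 2 ^ i" "1 / 2 ^ i \<le> 2 * real (T - t) / T"
proof -
  define m where "m = T - t"
  have m: "1 \<le> m" "m < T" "t = T - m" using assms by (auto simp: m_def)
  have "T \<ge> 2" using assms by simp
  note k = last_phase_bounds[OF this]
  \<comment> \<open>The phase is the one whose end is the first to come no earlier than \<open>t\<close>.\<close>
  define i where "i = (LEAST j. real T / 2 ^ (j + 1) \<le> m)"
  have *: "real T / 2 ^ (last_phase T - 1 + 1) \<le> m"
    using order.trans[OF k(2), of m] k(1) m by simp
  have i1: "real T / 2 ^ (i + 1) \<le> m"
    unfolding i_def using * by (rule LeastI)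
  have "i \<le> last_phase T - 1"
    unfolding i_def using * by (rule Least_le)
  then have ik: "i + 1 \<le> last_phase T" using k m by simp
  have i2: "real m < real T / 2 ^ i"
  proof (cases i)
    case (Suc j)
    then show ?thesis using not_less_Least[of j "\<lambda>j. real T / 2 ^ (j + 1) \<le> m"] i_def by force
  qed (use m in simp)
  have "nat \<lceil>real T / 2 ^ (i + 1)\<rceil> \<le> m" using i1 by (simp add: ceiling_le_iff nat_le_iff)
  then have "t \<le> phase_time T (i + 1)"
    unfolding phase_time_def if_P[OF ik] m(3) by (rule diff_le_mono2)
  moreover have "m < nat \<lceil>real T / 2 ^ i\<rceil>"
    using i2 by (simp add: less_ceiling_iff zless_nat_eq_int_zless)
  then have "phase_time T i < t"
    unfolding phase_time_def if_P[OF add_leD1[OF ik]] m(3) using m(2) by (rule diff_less_mono2)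
  moreover have "real m / T < 1 / 2 ^ i" "1 / 2 ^ i \<le> 2 * real m / T"
    using i1 i2 m by (simp_all add: field_simps)
  ultimately show thesis using add_leD1[OF ik] unfolding m_def by (intro that[of i])
qed

lemma phase_of_last_time:
  assumes "T \<ge> 2"
  shows "phase_time T (last_phase T) < T" "phase_time T (last_phase T + 1) = T"
    and "1 / (2 * real T) < 1 / (2::real) ^ last_phase T" "1 / 2 ^ last_phase T \<le> 1 / real T"
proof -
  note k = last_phase_bounds[OF assms]
  show "phase_time T (last_phase T) < T" using assms by (simp add: phase_time_def)
  show "phase_time T (last_phase T + 1) = T" by (simp add: phase_time_def)
  show "1 / 2 ^ last_phase T \<le> 1 / real T" using k(2) assms by (simp add: field_simps)
  obtain j where j: "last_phase T = Suc j" using k(1) gr0_conv_Suc by auto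
  then show "1 / (2 * real T) < 1 / (2::real) ^ last_phase T"
    using k(3) assms by (simp add: field_simps)
qed

lemma decreasing_steps_antimono:
  assumes "decreasing_steps c" "1 \<le> s" "s \<le> t"
  shows "c t \<le> c s"
  using \<open>s \<le> t\<close>
proof (induction t rule: dec_induct)
  case (step n)
  then show ?case using assms unfolding decreasing_steps_def
    by (metis Suc_eq_plus1 order.trans)
qed simp

text \<open>
  Two doublings lead from \<open>t\<close> to a time no earlier than \<open>T\<close>.
\<close>

lemma poly_decay_quarter:
  assumes dec: "decreasing_steps c" and decay: "poly_decay b c" and "1 \<le> t" "1 \<le> T" "T \<le> 4 * t"
  shows "c t \<le> c T / b\<^sup>2"
proof -
  have b: "0 < b" "\<And>t. 1 \<le> t \<Longrightarrow> b * c t \<le> c (2 * t)"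
    using decay by (auto simp: poly_decay_def)
  have "b\<^sup>2 * c t \<le> b * c (2 * t)"
    using b(2)[of t] b(1) \<open>1 \<le> t\<close> by (simp add: power2_eq_square)
  also have "\<dots> \<le> c (2 * (2 * t))" using b(2)[of "2 * t"] \<open>1 \<le> t\<close> by simp
  also have "\<dots> \<le> c T" using assms by (intro decreasing_steps_antimono) auto
  finally show ?thesis using b by (simp add: field_simps)
qed

text \<open>
  The step at the last time has no remaining time left and is bounded below separately. In the
  following lemmas \<open>m\<close> is the number of remaining steps.
\<close>

context
  fixes \<alpha> :: "nat \<Rightarrow> real" and c :: real and T :: nat
  assumes c: "0 < c" and T: "2 \<le> T"
    and lower: "\<And>t. \<lbrakk>1 \<le> t; t < T\<rbrakk> \<Longrightarrow> c * (T - t) / T \<le> \<alpha> t"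
    and last: "c / (2 * real T) \<le> \<alpha> T"
begin

lemma linear_decay_tail_sum:
  assumes "1 \<le> m" "m \<le> T"
  shows "c * (1 + real m * (m - 1)) / (2 * real T) \<le> tail_sum \<alpha> T (T - m)"
  using assms
proof (induction m rule: dec_induct)
  case base
  have "{T - 1<..T} = {T}" using T by auto
  then show ?case using last by (simp add: tail_sum_def)
next
  case (step m)
  have "tail_sum \<alpha> T (T - Suc m) = \<alpha> (T - m) + tail_sum \<alpha> T (T - m)"
    using tail_sum_step[of "T - Suc m" T \<alpha>] step by (simp add: Suc_diff_Suc)
  moreover have "c * real m / T \<le> \<alpha> (T - m)" using lower[of "T - m"] step T by (simp add: of_nat_diff)
  moreover have "c * (1 + real (Suc m) * (Suc m - 1)) / (2 * real T)
      = c * real m / T + c * (1 + real m * (real m - 1)) / (2 * real T)"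
    using T by (simp add: field_simps)
  ultimately show ?case using step by simp
qed

text \<open>
  A step size proportional to the remaining time \<open>m\<close> has a square proportional to \<open>m\<^sup>2\<close>,
  and so is the sum of the steps that remain; the ratio does not depend on \<open>m\<close>.
\<close>

lemma linear_decay_ratio:
  assumes "1 \<le> t" "t < T" and upper: "\<alpha> t \<le> 2 * C * real (T - t) / T"
  shows "(\<alpha> t)\<^sup>2 / tail_sum \<alpha> T t \<le> 11 * C\<^sup>2 / (c * T)"
proof -
  define m where "m = T - t"
  have m: "1 \<le> m" "t = T - m" "m \<le> T" using assms by (auto simp: m_def)
  \<comment> \<open>The difference of the two sides is the square of \<open>m / 2 - 1\<close>.\<close>
  have "3 / 4 * (real m)\<^sup>2 \<le> 1 + real m * (real m - 1)"
    using zero_le_power2[of "real m / 2 - 1"] by (simp add: power2_eq_square algebra_simps)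
  then have "c * (3 / 4 * (real m)\<^sup>2) / (2 * real T) \<le> c * (1 + real m * (real m - 1)) / (2 * real T)"
    using c by (intro divide_right_mono mult_left_mono) auto
  also have "\<dots> \<le> tail_sum \<alpha> T t"
    using linear_decay_tail_sum[of m] m by simp
  finally have S: "3 * c * (real m)\<^sup>2 / (8 * real T) \<le> tail_sum \<alpha> T t" by simp
  have "0 \<le> c * real (T - t) / T" using c by simp
  then have "0 \<le> \<alpha> t" using lower[of t] assms by simp
  then have A: "(\<alpha> t)\<^sup>2 \<le> (2 * C * real m / T)\<^sup>2"
    using upper by (intro power_mono) (auto simp: m_def)
  have "(\<alpha> t)\<^sup>2 / tail_sum \<alpha> T t \<le> (2 * C * real m / T)\<^sup>2 / (3 * c * (real m)\<^sup>2 / (8 * real T))"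
    using A S c m T by (intro frac_le) auto
  also have "\<dots> = 32 / 3 * C\<^sup>2 / (c * T)"
    using c m T by (simp add: field_simps power2_eq_square)
  also have "\<dots> \<le> 11 * C\<^sup>2 / (c * T)"
    using c T by (intro divide_right_mono mult_right_mono) auto
  finally show ?thesis .
qed

end

text \<open>
  For the degenerate case of the main theorem: repeated doubling from \<open>1\<close> leads beyond
  \<open>T\<close>, and each doubling loses only a positive factor.
\<close>

lemma poly_decay_zero:
  assumes dec: "decreasing_steps c" and decay: "poly_decay b c" and "1 \<le> T" "c T = 0" "1 \<le> t"
  shows "c t = 0"
proof -
  have b: "0 < b" "\<And>t. 1 \<le> t \<Longrightarrow> b * c t \<le> c (2 * t)"
    using decay by (auto simp: poly_decay_def)
  have pow: "b ^ n * c 1 \<le> c (2 ^ n)" for n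
  proof (induction n)
    case (Suc n)
    have "b * (b ^ n * c 1) \<le> b * c (2 ^ n)" using Suc b by (intro mult_left_mono) auto
    also have "\<dots> \<le> c (2 * 2 ^ n)" using b by simp
    finally show ?case by (simp add: ac_simps)
  qed simp
  have "b ^ T * c 1 \<le> c (2 ^ T)" by (rule pow)
  also have "\<dots> \<le> c T" using \<open>1 \<le> T\<close> by (intro decreasing_steps_antimono[OF dec]) (auto intro: less_imp_le)
  finally have "c 1 \<le> 0" using \<open>c T = 0\<close> b zero_less_power[OF b(1), of T] by (simp add: mult_le_0_iff)
  moreover have "c t \<le> c 1" using \<open>1 \<le> t\<close> by (intro decreasing_steps_antimono[OF dec]) auto
  moreover have "0 \<le> c t" using dec \<open>1 \<le> t\<close> by (auto simp: decreasing_steps_def)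
  ultimately show ?thesis by simp
qed

lemma halving_schedule_bounds:
  assumes T: "T \<ge> 2" and dec: "decreasing_steps \<gamma>" and decay: "poly_decay \<beta> \<gamma>"
    and \<alpha>: "\<And>i t. \<lbrakk>i \<le> last_phase T; phase_time T i < t; t \<le> phase_time T (i + 1)\<rbrakk>
               \<Longrightarrow> \<alpha> t = \<gamma> t / 2 ^ i"
  shows "\<And>t. \<lbrakk>1 \<le> t; t < T\<rbrakk> \<Longrightarrow> \<gamma> T * real (T - t) / T \<le> \<alpha> t"
    and "\<And>t. \<lbrakk>1 \<le> t; t < T; T \<le> 4 * t\<rbrakk> \<Longrightarrow> \<alpha> t \<le> 2 * (\<gamma> T / \<beta>\<^sup>2) * real (T - t) / T"
    and "\<gamma> T / (2 * real T) \<le> \<alpha> T" "\<alpha> T \<le> \<gamma> T / T"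
proof -
  have nn: "0 \<le> \<gamma> t" if "1 \<le> t" for t using dec that by (auto simp: decreasing_steps_def)
  fix t assume t: "1 \<le> t" "t < T"
  then obtain i where i: "i \<le> last_phase T" "phase_time T i < t" "t \<le> phase_time T (i + 1)"
    "real (T - t) / T < 1 / 2 ^ i" "1 / 2 ^ i \<le> 2 * real (T - t) / T"
    by (rule phase_of_time)
  then have eq: "\<alpha> t = \<gamma> t * (1 / 2 ^ i)" using \<alpha> by simp
  have "\<gamma> T * (real (T - t) / T) \<le> \<gamma> t * (1 / 2 ^ i)"
    using i t nn[of T] nn[of t] decreasing_steps_antimono[OF dec t(1), of T]
    by (intro mult_mono) auto
  then show "\<gamma> T * real (T - t) / T \<le> \<alpha> t" unfolding eq by simp
  show "\<alpha> t \<le> 2 * (\<gamma> T / \<beta>\<^sup>2) * real (T - t) / T" if "T \<le> 4 * t"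
  proof -
    have "\<gamma> t * (1 / 2 ^ i) \<le> (\<gamma> T / \<beta>\<^sup>2) * (2 * real (T - t) / T)"
      using i t nn[of T] nn[of t] poly_decay_quarter[OF dec decay t(1) _ that]
      by (intro mult_mono) auto
    then show ?thesis unfolding eq by (simp add: ac_simps)
  qed
next
  note k = phase_of_last_time[OF T]
  have eq: "\<alpha> T = \<gamma> T * (1 / 2 ^ last_phase T)" using \<alpha>[of "last_phase T" T] k by simp
  have "0 \<le> \<gamma> T" using dec T by (auto simp: decreasing_steps_def)
  then have "\<gamma> T * (1 / (2 * real T)) \<le> \<alpha> T" "\<alpha> T \<le> \<gamma> T * (1 / T)"
    unfolding eq using k(3,4) by (intro mult_left_mono; linarith)+
  then show "\<gamma> T / (2 * real T) \<le> \<alpha> T" "\<alpha> T \<le> \<gamma> T / T" by simp_all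
qed

text \<open>
  The reference mass is at most the inverse of the tail sum of \<open>w * \<alpha>\<close>, hence at most twice
  the inverse of the tail sum of \<open>\<alpha>\<close>, and \<open>linear_decay_ratio\<close> applies. Before the
  time \<open>start\<close> the step sizes may be large, but the mass is still \<open>0\<close> because \<open>q\<close> charges none
  of these times. In the last step the mass is exactly the inverse of \<open>w T * \<alpha> T\<close>.
\<close>

lemma linear_decay_reference_mass:
  fixes \<alpha> q w :: "nat \<Rightarrow> real" and c C :: real
  assumes c: "0 < c" "c \<le> C" and T: "2 \<le> T"
    and lower: "\<And>t. \<lbrakk>1 \<le> t; t < T\<rbrakk> \<Longrightarrow> c * real (T - t) / T \<le> \<alpha> t"
    and upper: "\<And>t. \<lbrakk>1 \<le> t; t < T; start \<le> t\<rbrakk> \<Longrightarrow> \<alpha> t \<le> 2 * C * real (T - t) / T"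
    and last: "c / (2 * real T) \<le> \<alpha> T" "\<alpha> T \<le> c / T"
    and q: "\<And>s. 0 \<le> q s" "\<And>s. s < start \<Longrightarrow> q s = 0" "(\<Sum>s=1..<T. q s) = 1"
    and w: "\<And>t. t \<le> T \<Longrightarrow> 1 / 2 \<le> w t"
    and t: "1 \<le> t" "t \<le> T"
  defines "a \<equiv> \<lambda>t. w t * \<alpha> t"
  shows "(\<alpha> t)\<^sup>2 * reference_mass a q T t \<le> 22 * C\<^sup>2 / (c * T)"
proof -
  have \<alpha>_pos: "0 < \<alpha> t" if "t \<in> {1..T}" for t
  proof (cases "t = T")
    case True
    have "0 < c / (2 * real T)" using c T by simp
    then show ?thesis unfolding True using last by linarith
  next
    case False
    then have "0 < c * real (T - t) / T" using c that by simp
    moreover have "c * real (T - t) / T \<le> \<alpha> t" using lower[of t] that False by simp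
    ultimately show ?thesis by linarith
  qed
  then have a: "0 < a t" if "t \<in> {1..T}" for t
    unfolding a_def using w[of t] that \<alpha>_pos[OF that] by (intro mult_pos_pos) auto
  show ?thesis
  proof (cases "t = T")
    case True
    let ?P = "reference_mass a q T T"
    have "{T - 1<..T} = {T}" "{1..<T} = {1..T - 1}" using T by auto
    moreover have "reference_mass a q T (T - 1) * tail_sum a T (T - 1) = (\<Sum>s=1..T - 1. q s)"
      using a T by (intro reference_mass_tail_sum) auto
    ultimately have "?P * a T = 1"
      using reference_mass_last[of T a q] T q(3) by (simp add: tail_sum_def)
    then have "\<alpha> T * ?P * w T = 1" by (simp add: a_def ac_simps)
    then have eq: "\<alpha> T * ?P = 1 / w T" using w[of T] by (simp add: field_simps)
    have "(\<alpha> T)\<^sup>2 * ?P = \<alpha> T * (1 / w T)" unfolding eq[symmetric] by (simp add: power2_eq_square)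
    also have "\<dots> \<le> c / T * (1 / (1 / 2))"
      using \<alpha>_pos[of T] last w[of T] T c by (intro mult_mono divide_left_mono) auto
    also have "\<dots> = 2 * c\<^sup>2 / (c * T)" using c by (simp add: power2_eq_square)
    also have "\<dots> \<le> 22 * C\<^sup>2 / (c * T)"
      using c by (intro divide_right_mono mult_mono power_mono) auto
    finally show ?thesis using True by simp
  next
    case False
    then have tT: "t < T" using t by simp
    have R: "0 < tail_sum a T t" using a tT by (rule tail_sum_pos)
    have S: "0 < tail_sum \<alpha> T t" using \<alpha>_pos tT by (rule tail_sum_pos)
    have eq: "reference_mass a q T t = (\<Sum>s=1..t. q s) / tail_sum a T t"
      using reference_mass_tail_sum[OF a tT, where q = q] R by (simp add: field_simps)
    show ?thesis
    proof (cases "t < start")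
      case True
      then show ?thesis using q eq c by simp
    next
      case False
      have "(1 / 2) * tail_sum \<alpha> T t \<le> tail_sum a T t"
        unfolding tail_sum_def sum_distrib_left a_def using \<alpha>_pos w
        by (intro sum_mono mult_right_mono) (auto intro: less_imp_le)
      moreover have "(\<Sum>s=1..t. q s) \<le> 1"
        unfolding q(3)[symmetric] using tT q by (intro sum_mono2) auto
      ultimately have "(\<alpha> t)\<^sup>2 * reference_mass a q T t \<le> (\<alpha> t)\<^sup>2 * (1 / ((1 / 2) * tail_sum \<alpha> T t))"
        unfolding eq using S by (intro mult_left_mono frac_le) auto
      also have "\<dots> = 2 * ((\<alpha> t)\<^sup>2 / tail_sum \<alpha> T t)" by simp
      also have "\<dots> \<le> 2 * (11 * C\<^sup>2 / (c * T))"
        using linear_decay_ratio[OF c(1) T lower last(1) t(1) tT, of C] upper[OF t(1) tT] False c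
        by (intro mult_left_mono) simp_all
      finally show ?thesis by simp
    qed
  qed
qed

section \<open>Independence and weighted sums\<close>

text \<open>
  The joint law of two independent sigma-algebras, seen through the diagonal map, is the
  product of the two restricted measures. In this form no random variable has to be singled
  out that summarizes the past.
\<close>

lemma nn_integral_indep_subalgebras:
  assumes "prob_space M" and A: "subalgebra M A" and B: "subalgebra M B"
    and indep: "prob_space.indep_set M (sets A) (sets B)"
    and f [measurable]: "f \<in> borel_measurable (A \<Otimes>\<^sub>M B)"
  shows "(\<integral>\<^sup>+\<omega>. f (\<omega>, \<omega>) \<partial>M) = (\<integral>\<^sup>+\<omega>. (\<integral>\<^sup>+\<omega>'. f (\<omega>', \<omega>) \<partial>M) \<partial>M)"
proof -
  interpret prob_space M by fact
  have [measurable]: "(\<lambda>\<omega>. \<omega>) \<in> measurable M A" "(\<lambda>\<omega>. \<omega>) \<in> measurable M B"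
    using A B by (auto simp: subalgebra_def measurable_def)
  have preimages: "sigma_sets (space M) {(\<lambda>\<omega>. \<omega>) -` S \<inter> space M |S. S \<in> sets N} = sets N"
    if "subalgebra M N" for N
  proof -
    have "{(\<lambda>\<omega>. \<omega>) -` S \<inter> space M |S. S \<in> sets N} = sets N"
      using that sets.sets_into_space[of _ N] by (auto simp: subalgebra_def Int_absorb2)
    then show ?thesis using that sets.sigma_sets_eq[of N] by (simp add: subalgebra_def)
  qed
  have "indep_var A (\<lambda>\<omega>. \<omega>) B (\<lambda>\<omega>. \<omega>)"
    unfolding indep_var_eq preimages[OF A] preimages[OF B] using indep by simp
  then have eq: "distr M A (\<lambda>\<omega>. \<omega>) \<Otimes>\<^sub>M distr M B (\<lambda>\<omega>. \<omega>) = distr M (A \<Otimes>\<^sub>M B) (\<lambda>\<omega>. (\<omega>, \<omega>))"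
    by (simp add: indep_var_distribution_eq)
  interpret MA: prob_space "distr M A (\<lambda>\<omega>. \<omega>)" by (rule prob_space_distr) simp
  interpret MB: prob_space "distr M B (\<lambda>\<omega>. \<omega>)" by (rule prob_space_distr) simp
  interpret AB: pair_sigma_finite "distr M A (\<lambda>\<omega>. \<omega>)" "distr M B (\<lambda>\<omega>. \<omega>)" ..
  have "(\<integral>\<^sup>+\<omega>. f (\<omega>, \<omega>) \<partial>M) = (\<integral>\<^sup>+z. f z \<partial>(distr M (A \<Otimes>\<^sub>M B) (\<lambda>\<omega>. (\<omega>, \<omega>))))"
    by (subst nn_integral_distr) simp_all
  also have "\<dots> = (\<integral>\<^sup>+z. f z \<partial>(distr M A (\<lambda>\<omega>. \<omega>) \<Otimes>\<^sub>M distr M B (\<lambda>\<omega>. \<omega>)))"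
    by (simp add: eq)
  also have "\<dots> = (\<integral>\<^sup>+\<omega>. (\<integral>\<^sup>+\<omega>'. f (\<omega>', \<omega>) \<partial>distr M A (\<lambda>\<omega>. \<omega>)) \<partial>distr M B (\<lambda>\<omega>. \<omega>))"
    by (rule AB.nn_integral_snd[symmetric]) simp
  also have "\<dots> = (\<integral>\<^sup>+\<omega>. (\<integral>\<^sup>+\<omega>'. f (\<omega>', \<omega>) \<partial>distr M A (\<lambda>\<omega>. \<omega>)) \<partial>M)"
    by (subst nn_integral_distr) simp_all
  also have "\<dots> = (\<integral>\<^sup>+\<omega>. (\<integral>\<^sup>+\<omega>'. f (\<omega>', \<omega>) \<partial>M) \<partial>M)"
  proof (rule nn_integral_cong)
    fix \<omega> assume "\<omega> \<in> space M"
    then have [simp]: "\<omega> \<in> space B" using B by (simp add: subalgebra_def)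
    show "(\<integral>\<^sup>+\<omega>'. f (\<omega>', \<omega>) \<partial>distr M A (\<lambda>\<omega>. \<omega>)) = (\<integral>\<^sup>+\<omega>'. f (\<omega>', \<omega>) \<partial>M)"
      by (subst nn_integral_distr) simp_all
  qed
  finally show ?thesis .
qed

lemma norm_weighted_sum_squared_le:
  fixes v :: "'i \<Rightarrow> 'b::real_normed_vector"
  assumes "\<And>i. i \<in> I \<Longrightarrow> 0 \<le> p i"
  shows "(norm (\<Sum>i\<in>I. p i *\<^sub>R v i))\<^sup>2 \<le> (\<Sum>i\<in>I. p i) * (\<Sum>i\<in>I. p i * (norm (v i))\<^sup>2)"
proof -
  have "norm (\<Sum>i\<in>I. p i *\<^sub>R v i) \<le> (\<Sum>i\<in>I. sqrt (p i) * (sqrt (p i) * norm (v i)))"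
    using assms by (intro sum_norm_le) (simp flip: mult.assoc)
  then have "(norm (\<Sum>i\<in>I. p i *\<^sub>R v i))\<^sup>2 \<le> (\<Sum>i\<in>I. sqrt (p i) * (sqrt (p i) * norm (v i)))\<^sup>2"
    by (intro power_mono) auto
  also have "\<dots> \<le> (\<Sum>i\<in>I. (sqrt (p i))\<^sup>2) * (\<Sum>i\<in>I. (sqrt (p i) * norm (v i))\<^sup>2)"
    by (rule Cauchy_Schwarz_ineq_sum)
  also have "\<dots> = (\<Sum>i\<in>I. p i) * (\<Sum>i\<in>I. p i * (norm (v i))\<^sup>2)"
    using assms by (intro arg_cong2[where f = "(*)"] sum.cong) (auto simp: power_mult_distrib)
  finally show ?thesis .
qed

section \<open>Bounded subgradient oracles and the exponential potential\<close>

text \<open>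
  The sigma-algebras \<open>A t\<close> witnessing independence are fixed here, so that the past up to a time
  becomes a measurable space of its own.
\<close>

locale bounded_subgradient_oracle = prob_space M
  for M :: "'w measure" +
  fixes A :: "nat \<Rightarrow> 'w measure" and W :: "'a::euclidean_space set" and F :: "'a \<Rightarrow> real"
    and h :: "nat \<Rightarrow> 'w \<Rightarrow> 'a \<Rightarrow> 'a" and G :: real
  assumes closed_W: "closed W" and convex_W: "convex W" and convex_F: "convex_on UNIV F"
    and subalgebra_A: "1 \<le> t \<Longrightarrow> subalgebra M (A t)"
    and indep_A: "indep_sets (\<lambda>t. sets (A t)) {1..}"
    and joint_measurable:
      "1 \<le> t \<Longrightarrow> (\<lambda>(\<omega>, z). h t \<omega> z) \<in> borel_measurable (A t \<Otimes>\<^sub>M restrict_space borel W)"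
    and mean_subgradient: "1 \<le> t \<Longrightarrow> z \<in> W \<Longrightarrow> (\<integral>\<omega>. h t \<omega> z \<partial>M) \<in> subdifferential F z"
    and norm_le_AE: "1 \<le> t \<Longrightarrow> z \<in> W \<Longrightarrow> AE \<omega> in M. norm (h t \<omega> z) \<le> G"
begin

definition past :: "nat \<Rightarrow> 'w measure"
  where "past n = sigma (space M) (\<Union>s\<in>{1..<n}. sets (A s))"

lemma past_generators: "(\<Union>s\<in>{1..<n}. sets (A s)) \<subseteq> Pow (space M)"
  using subalgebra_A sets.sets_into_space by (fastforce simp: subalgebra_def)

lemma space_past [simp]: "space (past n) = space M"
  unfolding past_def by (rule space_measure_of[OF past_generators])

lemma sets_past: "sets (past n) = sigma_sets (space M) (\<Union>s\<in>{1..<n}. sets (A s))"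
  unfolding past_def by (rule sets_measure_of[OF past_generators])

lemma subalgebra_past: "subalgebra M (past n)"
proof -
  have "(\<Union>s\<in>{1..<n}. sets (A s)) \<subseteq> sets M"
  proof
    fix S assume "S \<in> (\<Union>s\<in>{1..<n}. sets (A s))"
    then obtain s where "1 \<le> s" "S \<in> sets (A s)" by auto
    then show "S \<in> sets M" using subalgebra_A[of s] by (auto simp: subalgebra_def)
  qed
  then have "sets (past n) \<subseteq> sets M" unfolding sets_past by (rule sets.sigma_sets_subset)
  then show ?thesis by (simp add: subalgebra_def)
qed

lemma past_mono: "m \<le> n \<Longrightarrow> sets (past m) \<subseteq> sets (past n)"
  unfolding sets_past by (intro sigma_sets_mono' UN_mono) auto

lemma sets_A_past: "1 \<le> s \<Longrightarrow> s < n \<Longrightarrow> sets (A s) \<subseteq> sets (past n)"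
  unfolding sets_past by (intro subsetI sigma_sets.Basic) auto

lemma measurable_past_mono:
  assumes "f \<in> measurable (past m) N" "m \<le> n"
  shows "f \<in> measurable (past n) N"
  using assms past_mono[OF assms(2)] by (auto simp: measurable_def)

lemma indep_past:
  assumes "1 \<le> n"
  shows "indep_set (sets (A n)) (sets (past n))"
proof -
  let ?I = "case_bool {n} {1..<n}"
  have "indep_sets (\<lambda>j. sigma_sets (space M) (\<Union>i\<in>?I j. sets (A i))) UNIV"
  proof (rule indep_sets_collect_sigma)
    show "indep_sets (\<lambda>t. sets (A t)) (\<Union>j\<in>UNIV. ?I j)"
      using assms by (intro indep_sets_mono_index[OF _ indep_A]) (auto split: bool.splits)
    show "Int_stable (sets (A i))" for i by (rule sets.Int_stable)
    show "disjoint_family_on ?I UNIV" by (auto simp: disjoint_family_on_def split: bool.splits)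
  qed
  moreover have "sigma_sets (space M) (sets (A n)) = sets (A n)"
    using subalgebra_A[OF assms] sets.sigma_sets_eq[of "A n"] by (simp add: subalgebra_def)
  then have "(\<lambda>j. sigma_sets (space M) (\<Union>i\<in>?I j. sets (A i))) = case_bool (sets (A n)) (sets (past n))"
    by (auto simp: fun_eq_iff sets_past split: bool.split)
  ultimately show ?thesis by (simp add: indep_set_def)
qed

lemma measurable_F [measurable]: "F \<in> borel_measurable borel"
  by (intro borel_measurable_continuous_onI convex_on_continuous convex_F) simp

lemma measurable_closest_point: "closest_point W \<in> borel_measurable borel" if "W \<noteq> {}"
  by (intro borel_measurable_continuous_onI continuous_on_closest_point closed_W convex_W that)

lemma measurable_oracle_at:
  assumes "1 \<le> t" "z \<in> W"
  shows "(\<lambda>\<omega>. h t \<omega> z) \<in> borel_measurable M"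
proof -
  have "(\<lambda>\<omega>. (\<omega>, z)) \<in> A t \<rightarrow>\<^sub>M A t \<Otimes>\<^sub>M restrict_space borel W"
    using assms by (intro measurable_Pair2') (simp add: space_restrict_space)
  from measurable_compose[OF this joint_measurable[OF assms(1)]]
  have "(\<lambda>\<omega>. h t \<omega> z) \<in> borel_measurable (A t)" by simp
  then show ?thesis
    using subalgebra_A[OF assms(1)] by (auto simp: subalgebra_def intro: borel_measurable_subalgebra)
qed

lemma norm_bound_nonneg: "z \<in> W \<Longrightarrow> 0 \<le> G"
proof -
  assume "z \<in> W"
  have "AE \<omega> in M. 0 \<le> G"
    using norm_le_AE[OF order.refl \<open>z \<in> W\<close>] by eventually_elim (use norm_ge_zero order_trans in blast)
  then show ?thesis by simp
qed

text \<open>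
  The inner product with a fixed vector \<open>d\<close> ranges over an interval of length \<open>2 G |d|\<close>, so that
  Hoeffding's lemma applies without bounding the noise itself. The mean is only bounded
  from below, by a number \<open>b\<close> which will be a gap of function values; this avoids any
  measurability question about the mean as a function of the point.
\<close>

lemma oracle_exp_moment:
  assumes "1 \<le> t" "z \<in> W" "0 \<le> l" and b: "b \<le> (\<integral>\<omega>. h t \<omega> z \<partial>M) \<bullet> d"
  shows "(\<integral>\<^sup>+\<omega>. exp (- l * (h t \<omega> z \<bullet> d)) \<partial>M) \<le> exp (- l * b + l\<^sup>2 * G\<^sup>2 * (norm d)\<^sup>2 / 2)"
proof (cases "l = 0")
  case True
  then show ?thesis by (simp add: emeasure_space_1)
next
  case False
  then have "0 < l" using assms by simp
  note [measurable] = measurable_oracle_at[OF assms(1,2)]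
  note bd = norm_le_AE[OF assms(1,2)]
  interpret H: interval_bounded_random_variable M "\<lambda>\<omega>. - (h t \<omega> z \<bullet> d)" "- (G * norm d)" "G * norm d"
  proof
    show "AE \<omega> in M. - (h t \<omega> z \<bullet> d) \<in> {- (G * norm d)..G * norm d}"
      using bd
    proof eventually_elim
      case (elim \<omega>)
      have "\<bar>h t \<omega> z \<bullet> d\<bar> \<le> norm (h t \<omega> z) * norm d" by (rule Cauchy_Schwarz_ineq2)
      also have "\<dots> \<le> G * norm d" using elim by (intro mult_right_mono) auto
      finally show ?case by auto
    qed
  qed simp
  have "integrable M (\<lambda>\<omega>. h t \<omega> z)" using bd by (intro integrable_const_bound[where B = G]) auto
  then have mu: "expectation (\<lambda>\<omega>. - (h t \<omega> z \<bullet> d)) = - ((\<integral>\<omega>. h t \<omega> z \<partial>M) \<bullet> d)"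
    by simp
  let ?m = "(\<integral>\<omega>. h t \<omega> z \<partial>M) \<bullet> d"
  have "(\<integral>\<^sup>+\<omega>. exp (- l * (h t \<omega> z \<bullet> d)) \<partial>M)
      = (\<integral>\<^sup>+\<omega>. ennreal (exp (- l * ?m)) * exp (l * (- (h t \<omega> z \<bullet> d) - - ?m)) \<partial>M)"
    by (intro nn_integral_cong) (simp add: algebra_simps flip: ennreal_mult exp_add)
  also have "\<dots> = exp (- l * ?m) * (\<integral>\<^sup>+\<omega>. exp (l * (- (h t \<omega> z \<bullet> d) - - ?m)) \<partial>M)"
    by (rule nn_integral_cmult) simp
  also have "\<dots> \<le> ennreal (exp (- l * ?m)) * exp (l\<^sup>2 * (G * norm d - - (G * norm d))\<^sup>2 / 8)"
    using H.Hoeffdings_lemma_nn_integral[OF \<open>0 < l\<close>] unfolding mu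
    by (intro mult_left_mono) auto
  also have "\<dots> = exp (- l * ?m + l\<^sup>2 * G\<^sup>2 * (norm d)\<^sup>2 / 2)"
    by (simp add: power2_eq_square algebra_simps flip: ennreal_mult exp_add)
  also have "\<dots> \<le> exp (- l * b + l\<^sup>2 * G\<^sup>2 * (norm d)\<^sup>2 / 2)"
    using b \<open>0 < l\<close> by (intro ennreal_leI) simp
  finally show ?thesis .
qed

abbreviation iterate :: "(nat \<Rightarrow> real) \<Rightarrow> 'a \<Rightarrow> nat \<Rightarrow> 'w \<Rightarrow> 'a"
  where "iterate \<alpha> x1 t \<omega> \<equiv> sgd W \<alpha> (\<lambda>s. h s \<omega>) x1 t"

lemma iterate_step:
  "1 \<le> t \<Longrightarrow> iterate \<alpha> x1 (Suc t) \<omega> =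
     closest_point W (iterate \<alpha> x1 t \<omega> - \<alpha> t *\<^sub>R h t \<omega> (iterate \<alpha> x1 t \<omega>))"
  by (cases t) auto

lemma iterate_in_W: "x1 \<in> W \<Longrightarrow> iterate \<alpha> x1 t \<omega> \<in> W"
proof (induction t)
  case (Suc t)
  then show ?case
    by (cases t) (auto intro!: closest_point_in_set closed_W)
qed simp

lemma measurable_oracle_compose:
  assumes "1 \<le> t" "f \<in> measurable N (A t)" "g \<in> measurable N (restrict_space borel W)"
  shows "(\<lambda>z. h t (f z) (g z)) \<in> borel_measurable N"
  using measurable_compose[OF measurable_Pair[OF assms(2,3)] joint_measurable[OF assms(1)]]
  by simp

text \<open>
  The target is the subspace \<open>W\<close> rather than the whole space because the oracle is jointly measurable
  there only.
\<close>

lemma measurable_iterate: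
  assumes "x1 \<in> W" "1 \<le> t"
  shows "iterate \<alpha> x1 t \<in> measurable (past t) (restrict_space borel W)"
  using \<open>1 \<le> t\<close>
proof (induction t rule: dec_induct)
  case base
  then show ?case using assms by (simp add: space_restrict_space)
next
  case (step t)
  have [measurable]: "closest_point W \<in> borel_measurable borel"
    using assms measurable_closest_point by auto
  have it: "iterate \<alpha> x1 t \<in> measurable (past (Suc t)) (restrict_space borel W)"
    using step by (rule_tac measurable_past_mono) auto
  have [measurable]: "iterate \<alpha> x1 t \<in> borel_measurable (past (Suc t))"
    using it by (simp add: measurable_restrict_space2_iff)
  have "(\<lambda>\<omega>. \<omega>) \<in> measurable (past (Suc t)) (A t)"
    using step subalgebra_A[of t] sets_A_past[of t "Suc t"] sets.sets_into_space
    by (fastforce simp: measurable_def subalgebra_def Int_absorb2)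
  from measurable_oracle_compose[OF _ this it] step
  have [measurable]: "(\<lambda>\<omega>. h t \<omega> (iterate \<alpha> x1 t \<omega>)) \<in> borel_measurable (past (Suc t))"
    by simp
  have "iterate \<alpha> x1 (Suc t) \<in> borel_measurable (past (Suc t))"
    unfolding iterate_step[OF step(1)] by measurable
  then show ?case
    using iterate_in_W[OF assms(1)] by (auto simp: measurable_restrict_space2_iff)
qed

lemma measurable_iterate_past:
  assumes "x1 \<in> W" "1 \<le> t" "t \<le> n"
  shows "iterate \<alpha> x1 t \<in> borel_measurable (past n)"
  using measurable_past_mono[OF measurable_iterate[OF assms(1,2)] assms(3)]
  by (simp add: measurable_restrict_space2_iff)

lemma measurable_iterate_M:
  assumes "x1 \<in> W"
  shows "iterate \<alpha> x1 t \<in> borel_measurable M"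
proof (cases t)
  case (Suc n)
  have "iterate \<alpha> x1 t \<in> borel_measurable (past t)"
    using Suc assms by (intro measurable_iterate_past) auto
  then show ?thesis
    using subalgebra_past[of t]
    by (auto simp: subalgebra_def measurable_def)
qed simp

text \<open>
  The projection is nonexpansive and fixes the reference points, so it can be dropped; the rest is
  the expansion of the square, summed over all reference points.
\<close>

lemma projected_step_distances:
  assumes "norm v \<le> G"
    and p: "\<And>s. 0 \<le> p s" and u: "\<And>s. s \<in> I \<Longrightarrow> u s \<in> W"
  shows "(\<Sum>s\<in>I. p s * (norm (closest_point W (z - \<eta> *\<^sub>R v) - u s))\<^sup>2)
    \<le> (\<Sum>s\<in>I. p s * (norm (z - u s))\<^sup>2) - 2 * \<eta> * (v \<bullet> (\<Sum>s\<in>I. p s *\<^sub>R (z - u s)))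
       + \<eta>\<^sup>2 * G\<^sup>2 * (\<Sum>s\<in>I. p s)"
proof -
  have "p s * (norm (closest_point W (z - \<eta> *\<^sub>R v) - u s))\<^sup>2
      \<le> p s * (norm (z - u s))\<^sup>2 - 2 * \<eta> * (v \<bullet> (p s *\<^sub>R (z - u s))) + \<eta>\<^sup>2 * G\<^sup>2 * p s"
    if s: "s \<in> I" for s
  proof -
    have "dist (closest_point W (z - \<eta> *\<^sub>R v)) (closest_point W (u s)) \<le> dist (z - \<eta> *\<^sub>R v) (u s)"
      using u[OF s] by (intro closest_point_lipschitz convex_W closed_W) auto
    then have "norm (closest_point W (z - \<eta> *\<^sub>R v) - u s) \<le> norm (z - \<eta> *\<^sub>R v - u s)"
      using u[OF s] by (simp add: dist_norm closest_point_self)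
    then have "(norm (closest_point W (z - \<eta> *\<^sub>R v) - u s))\<^sup>2 \<le> (norm ((z - u s) - \<eta> *\<^sub>R v))\<^sup>2"
      by (intro power_mono) (auto simp: algebra_simps)
    also have "\<dots> = (norm (z - u s))\<^sup>2 - 2 * \<eta> * (v \<bullet> (z - u s)) + \<eta>\<^sup>2 * (norm v)\<^sup>2"
      unfolding power2_norm_eq_inner
      by (simp add: inner_diff_left inner_diff_right inner_commute algebra_simps power2_eq_square)
    also have "\<dots> \<le> (norm (z - u s))\<^sup>2 - 2 * \<eta> * (v \<bullet> (z - u s)) + \<eta>\<^sup>2 * G\<^sup>2"
      using assms by (intro add_left_mono mult_left_mono power_mono) auto
    finally have "p s * (norm (closest_point W (z - \<eta> *\<^sub>R v) - u s))\<^sup>2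
        \<le> p s * ((norm (z - u s))\<^sup>2 - 2 * \<eta> * (v \<bullet> (z - u s)) + \<eta>\<^sup>2 * G\<^sup>2)"
      using p by (intro mult_left_mono)
    then show ?thesis by (simp add: algebra_simps)
  qed
  then have "(\<Sum>s\<in>I. p s * (norm (closest_point W (z - \<eta> *\<^sub>R v) - u s))\<^sup>2)
      \<le> (\<Sum>s\<in>I. p s * (norm (z - u s))\<^sup>2 - 2 * \<eta> * (v \<bullet> (p s *\<^sub>R (z - u s))) + \<eta>\<^sup>2 * G\<^sup>2 * p s)"
    by (rule sum_mono)
  then show ?thesis
    by (simp add: sum.distrib sum_subtractf sum_distrib_left inner_sum_right)
qed

text \<open>
  The exponential moment of the noise costs \<open>2 l^2 \<eta>^2 G^2 w^2 |d|^2\<close> in the exponent, and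
  \<open>|d|^2 \<le> P * V\<close>. Passing from the weight \<open>w'\<close> to the smaller weight \<open>w\<close> releases
  \<open>l (w' - w) V\<close>, and the last assumption says that this is enough. Thus the cost of the noise
  is paid by the potential, whatever the size of \<open>V\<close>.
\<close>

lemma one_step_exp_moment:
  fixes p :: "nat \<Rightarrow> real" and u :: "nat \<Rightarrow> 'a"
  assumes "1 \<le> t" "0 \<le> \<eta>" "0 \<le> w" "0 \<le> l" "z \<in> W"
    and p: "\<And>s. 0 \<le> p s" and u: "\<And>s. s \<in> I \<Longrightarrow> u s \<in> W"
  defines "P \<equiv> \<Sum>s\<in>I. p s" and "V \<equiv> \<Sum>s\<in>I. p s * (norm (z - u s))\<^sup>2"
    and "L \<equiv> (\<Sum>s\<in>I. p s) * F z - (\<Sum>s\<in>I. p s * F (u s))"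
  assumes w': "w + 2 * l * \<eta>\<^sup>2 * G\<^sup>2 * P * w\<^sup>2 \<le> w'"
  shows "(\<integral>\<^sup>+\<omega>. exp (l * (w * (\<Sum>s\<in>I. p s * (norm (closest_point W (z - \<eta> *\<^sub>R h t \<omega> z) - u s))\<^sup>2)
             + (2 * w * \<eta> * L - w * \<eta>\<^sup>2 * G\<^sup>2 * P))) \<partial>M)
         \<le> exp (l * (w' * V))"
proof -
  let ?D = "\<lambda>\<omega>. \<Sum>s\<in>I. p s * (norm (closest_point W (z - \<eta> *\<^sub>R h t \<omega> z) - u s))\<^sup>2"
  define d where "d = (\<Sum>s\<in>I. p s *\<^sub>R (z - u s))"
  define m where "m = (\<integral>\<omega>. h t \<omega> z \<partial>M)"
  note [measurable] = measurable_oracle_at[OF assms(1,5)]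
  have V: "0 \<le> V" unfolding V_def using p by (intro sum_nonneg) auto
  have "L = (\<Sum>s\<in>I. p s * (F z - F (u s)))"
    by (simp add: L_def right_diff_distrib sum_subtractf flip: sum_distrib_right)
  also have "\<dots> \<le> (\<Sum>s\<in>I. p s * (m \<bullet> (z - u s)))"
  proof (intro sum_mono mult_left_mono p)
    fix s
    have "F z + m \<bullet> (u s - z) \<le> F (u s)"
      using mean_subgradient[OF assms(1,5)] by (simp add: m_def subdifferential_def)
    then show "F z - F (u s) \<le> m \<bullet> (z - u s)" by (simp add: inner_diff_right)
  qed
  also have "\<dots> = m \<bullet> d" by (simp add: d_def inner_sum_right)
  finally have L: "L \<le> m \<bullet> d" .
  have "(norm d)\<^sup>2 \<le> P * V"
    unfolding d_def P_def V_def using p by (rule norm_weighted_sum_squared_le)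
  then have "2 * l * \<eta>\<^sup>2 * G\<^sup>2 * w\<^sup>2 * (norm d)\<^sup>2 \<le> 2 * l * \<eta>\<^sup>2 * G\<^sup>2 * w\<^sup>2 * (P * V)"
    using assms by (intro mult_left_mono) auto
  also have "w * V + \<dots> = (w + 2 * l * \<eta>\<^sup>2 * G\<^sup>2 * P * w\<^sup>2) * V" by (simp add: algebra_simps)
  also have "\<dots> \<le> w' * V" using w' V by (rule mult_right_mono)
  finally have bound: "w * V + 2 * l * \<eta>\<^sup>2 * G\<^sup>2 * w\<^sup>2 * (norm d)\<^sup>2 \<le> w' * V" by simp
  let ?c = "l * w * V + 2 * l * w * \<eta> * L"
  have "(\<integral>\<^sup>+\<omega>. exp (l * (w * ?D \<omega> + (2 * w * \<eta> * L - w * \<eta>\<^sup>2 * G\<^sup>2 * P))) \<partial>M)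
      \<le> (\<integral>\<^sup>+\<omega>. ennreal (exp ?c) * exp (- (2 * l * w * \<eta>) * (h t \<omega> z \<bullet> d)) \<partial>M)"
  proof (rule nn_integral_mono_AE)
    show "AE \<omega> in M. ennreal (exp (l * (w * ?D \<omega> + (2 * w * \<eta> * L - w * \<eta>\<^sup>2 * G\<^sup>2 * P))))
        \<le> ennreal (exp ?c) * exp (- (2 * l * w * \<eta>) * (h t \<omega> z \<bullet> d))"
      using norm_le_AE[OF assms(1,5)]
    proof eventually_elim
      case (elim \<omega>)
      have "?D \<omega> \<le> V - 2 * \<eta> * (h t \<omega> z \<bullet> d) + \<eta>\<^sup>2 * G\<^sup>2 * P"
        unfolding V_def d_def P_def
        by (rule projected_step_distances[OF elim p u])
      then have "(l * w) * ?D \<omega> \<le> (l * w) * (V - 2 * \<eta> * (h t \<omega> z \<bullet> d) + \<eta>\<^sup>2 * G\<^sup>2 * P)"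
        using assms by (intro mult_left_mono) auto
      then have "l * (w * ?D \<omega> + (2 * w * \<eta> * L - w * \<eta>\<^sup>2 * G\<^sup>2 * P))
          \<le> ?c + - (2 * l * w * \<eta>) * (h t \<omega> z \<bullet> d)"
        by (simp add: algebra_simps)
      then show ?case by (simp flip: ennreal_mult exp_add)
    qed
  qed
  also have "\<dots> = exp ?c * (\<integral>\<^sup>+\<omega>. exp (- (2 * l * w * \<eta>) * (h t \<omega> z \<bullet> d)) \<partial>M)"
    by (rule nn_integral_cmult) simp
  also have "\<dots> \<le> ennreal (exp ?c) *
      exp (- (2 * l * w * \<eta>) * L + (2 * l * w * \<eta>)\<^sup>2 * G\<^sup>2 * (norm d)\<^sup>2 / 2)"
    using assms L unfolding m_def by (intro mult_left_mono oracle_exp_moment) auto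
  also have "\<dots> = exp (l * (w * V + 2 * l * \<eta>\<^sup>2 * G\<^sup>2 * w\<^sup>2 * (norm d)\<^sup>2))"
    by (simp add: power2_eq_square algebra_simps flip: ennreal_mult exp_add)
  also have "\<dots> \<le> exp (l * (w' * V))"
    using bound assms by (intro ennreal_leI) (auto intro: mult_left_mono)
  finally show ?thesis .
qed

text \<open>
  The squared step sizes are subtracted because they are the deterministic increments of the potential.
\<close>

definition gap_sum :: "(nat \<Rightarrow> real) \<Rightarrow> (nat \<Rightarrow> real) \<Rightarrow> (nat \<Rightarrow> real) \<Rightarrow> 'a \<Rightarrow> nat \<Rightarrow> 'w \<Rightarrow> real"
  where "gap_sum \<alpha> w p x1 n \<omega> = (\<Sum>t=1..n.
     2 * w t * \<alpha> t * ((\<Sum>s=1..t. p s) * F (iterate \<alpha> x1 t \<omega>) - (\<Sum>s=1..t. p s * F (iterate \<alpha> x1 s \<omega>)))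
     - w t * (\<alpha> t)\<^sup>2 * G\<^sup>2 * (\<Sum>s=1..t. p s))"

lemma gap_sum_Suc: "gap_sum \<alpha> w p x1 (Suc n) \<omega> = gap_sum \<alpha> w p x1 n \<omega> +
  (2 * w (Suc n) * \<alpha> (Suc n) * ((\<Sum>s=1..Suc n. p s) * F (iterate \<alpha> x1 (Suc n) \<omega>)
      - (\<Sum>s=1..Suc n. p s * F (iterate \<alpha> x1 s \<omega>)))
     - w (Suc n) * (\<alpha> (Suc n))\<^sup>2 * G\<^sup>2 * (\<Sum>s=1..Suc n. p s))"
  unfolding gap_sum_def by simp

lemma measurable_gap_sum_past:
  assumes "x1 \<in> W" "n \<le> m"
  shows "gap_sum \<alpha> w p x1 n \<in> borel_measurable (past m)"
  unfolding gap_sum_def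
  by (intro borel_measurable_sum borel_measurable_diff borel_measurable_times borel_measurable_const
      measurable_compose[OF measurable_iterate_past[OF assms(1)] measurable_F])
     (use assms in auto)

text \<open>
  This is the supermartingale property, proved by induction on the number of steps. Given the past, the
  new iterate is a function of the fresh noise, and \<open>one_step_exp_moment\<close> bounds the inner integral.
  The reference point \<open>x\<^sub>n\<^sub>+\<^sub>1\<close> which joins the potential in this step contributes
  nothing to it beforehand, since its distance from the current iterate is zero.
\<close>

lemma potential_exp_moment:
  assumes x1: "x1 \<in> W" and "0 \<le> l"
    and nonneg: "\<And>t. 1 \<le> t \<Longrightarrow> t \<le> N \<Longrightarrow> 0 \<le> \<alpha> t" "\<And>t. t \<le> N \<Longrightarrow> 0 \<le> w t" "\<And>s. 0 \<le> p s"
    and w: "\<And>t. 1 \<le> t \<Longrightarrow> t \<le> N \<Longrightarrow>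
        w t + 2 * l * (\<alpha> t)\<^sup>2 * G\<^sup>2 * (\<Sum>s=1..t. p s) * (w t)\<^sup>2 \<le> w (t - 1)"
    and "n \<le> N"
  shows "(\<integral>\<^sup>+\<omega>. exp (l * (w n * (\<Sum>s=1..n. p s *
              (norm (iterate \<alpha> x1 (Suc n) \<omega> - iterate \<alpha> x1 s \<omega>))\<^sup>2)
            + gap_sum \<alpha> w p x1 n \<omega>)) \<partial>M) \<le> 1"
  using \<open>n \<le> N\<close>
proof (induction n)
  case 0
  then show ?case by (simp add: gap_sum_def emeasure_space_1)
next
  case (Suc n)
  define m where "m = Suc n"
  have m: "1 \<le> m" "m \<le> N" "m - 1 = n" using Suc by (auto simp: m_def)
  let ?x = "iterate \<alpha> x1"
  have [measurable]: "closest_point W \<in> borel_measurable borel"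
    using x1 measurable_closest_point by auto
  define L where "L \<omega> = (\<Sum>s=1..m. p s) * F (?x m \<omega>) - (\<Sum>s=1..m. p s * F (?x s \<omega>))" for \<omega>
  let ?g = "\<lambda>\<omega>. 2 * w m * \<alpha> m * L \<omega> - w m * (\<alpha> m)\<^sup>2 * G\<^sup>2 * (\<Sum>s=1..m. p s)"
  let ?D = "\<lambda>\<omega>' \<omega>. \<Sum>s=1..m. p s *
      (norm (closest_point W (?x m \<omega> - \<alpha> m *\<^sub>R h m \<omega>' (?x m \<omega>)) - ?x s \<omega>))\<^sup>2"
  \<comment> \<open>The first argument carries the noise of step \<open>m\<close>, the second one everything before it.\<close>
  define f where "f = (\<lambda>(\<omega>', \<omega>). ennreal (exp (l * (w m * ?D \<omega>' \<omega> + (gap_sum \<alpha> w p x1 n \<omega> + ?g \<omega>)))))"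
  have it: "?x s \<in> borel_measurable (past m)" if "s \<in> {1..m}" for s
    using that x1 by (intro measurable_iterate_past) auto
  have [measurable]: "?x m \<in> borel_measurable (past m)" using it m by auto
  have [measurable]: "gap_sum \<alpha> w p x1 n \<in> borel_measurable (past m)"
    using x1 by (intro measurable_gap_sum_past) (auto simp: m_def)
  have [measurable]: "L \<in> borel_measurable (past m)"
    unfolding L_def
    by (intro borel_measurable_diff borel_measurable_sum borel_measurable_times borel_measurable_const
        measurable_compose[OF it measurable_F]) (use m in auto)
  have [measurable]: "(\<lambda>z. h m (fst z) (?x m (snd z))) \<in> borel_measurable (A m \<Otimes>\<^sub>M past m)"
    using measurable_compose[OF measurable_snd measurable_iterate[OF x1 m(1)]]
    by (intro measurable_oracle_compose m) auto
  have "(\<lambda>z. ?D (fst z) (snd z)) \<in> borel_measurable (A m \<Otimes>\<^sub>M past m)"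
  proof (rule borel_measurable_sum)
    fix s assume "s \<in> {1..m}"
    note [measurable] = it[OF this]
    show "(\<lambda>z. p s * (norm (closest_point W (?x m (snd z) - \<alpha> m *\<^sub>R h m (fst z) (?x m (snd z)))
        - ?x s (snd z)))\<^sup>2) \<in> borel_measurable (A m \<Otimes>\<^sub>M past m)"
      by measurable
  qed
  then have f: "f \<in> borel_measurable (A m \<Otimes>\<^sub>M past m)"
    unfolding f_def case_prod_unfold by measurable
  have "(\<integral>\<^sup>+\<omega>. exp (l * (w m * (\<Sum>s=1..m. p s * (norm (?x (Suc m) \<omega> - ?x s \<omega>))\<^sup>2)
            + gap_sum \<alpha> w p x1 m \<omega>)) \<partial>M) = (\<integral>\<^sup>+\<omega>. f (\<omega>, \<omega>) \<partial>M)"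
    unfolding f_def iterate_step[OF m(1)] L_def m_def gap_sum_Suc by simp
  also have "\<dots> = (\<integral>\<^sup>+\<omega>. (\<integral>\<^sup>+\<omega>'. f (\<omega>', \<omega>) \<partial>M) \<partial>M)"
    by (rule nn_integral_indep_subalgebras[OF prob_space_axioms subalgebra_A[OF m(1)]
          subalgebra_past indep_past[OF m(1)] f])
  also have "\<dots> \<le> (\<integral>\<^sup>+\<omega>. exp (l * (w n * (\<Sum>s=1..n. p s * (norm (?x (Suc n) \<omega> - ?x s \<omega>))\<^sup>2)
            + gap_sum \<alpha> w p x1 n \<omega>)) \<partial>M)"
  proof (rule nn_integral_mono)
    fix \<omega> assume "\<omega> \<in> space M"
    let ?z = "?x m \<omega>"
    have z: "?z \<in> W" using x1 by (rule iterate_in_W)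
    note [measurable] = measurable_oracle_at[OF m(1) z]
    have "(\<integral>\<^sup>+\<omega>'. f (\<omega>', \<omega>) \<partial>M)
        = (\<integral>\<^sup>+\<omega>'. ennreal (exp (l * gap_sum \<alpha> w p x1 n \<omega>)) * exp (l * (w m * ?D \<omega>' \<omega> + ?g \<omega>)) \<partial>M)"
      unfolding f_def by (intro nn_integral_cong) (simp add: algebra_simps flip: ennreal_mult exp_add)
    also have "\<dots> = exp (l * gap_sum \<alpha> w p x1 n \<omega>) * (\<integral>\<^sup>+\<omega>'. exp (l * (w m * ?D \<omega>' \<omega> + ?g \<omega>)) \<partial>M)"
      by (rule nn_integral_cmult) measurable
    also have "\<dots> \<le> ennreal (exp (l * gap_sum \<alpha> w p x1 n \<omega>)) *
        exp (l * (w n * (\<Sum>s=1..m. p s * (norm (?z - ?x s \<omega>))\<^sup>2)))"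
      unfolding L_def
      by (intro mult_left_mono one_step_exp_moment)
         (use m z nonneg w[of m] \<open>0 \<le> l\<close> iterate_in_W[OF x1] in auto)
    also have "(\<Sum>s=1..m. p s * (norm (?z - ?x s \<omega>))\<^sup>2) = (\<Sum>s=1..n. p s * (norm (?x (Suc n) \<omega> - ?x s \<omega>))\<^sup>2)"
      unfolding m_def by simp
    finally show "(\<integral>\<^sup>+\<omega>'. f (\<omega>', \<omega>) \<partial>M) \<le> exp (l * (w n *
        (\<Sum>s=1..n. p s * (norm (?x (Suc n) \<omega> - ?x s \<omega>))\<^sup>2) + gap_sum \<alpha> w p x1 n \<omega>))"
      by (simp add: algebra_simps flip: ennreal_mult exp_add)
  qed
  also have "\<dots> \<le> 1" using Suc by simp
  finally show ?case unfolding m_def .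
qed

text \<open>
  A Chernoff bound; the potential is nonnegative and can be discarded at the final time.
\<close>

lemma gap_sum_tail_bound:
  assumes x1: "x1 \<in> W" and "0 < l" "0 < \<epsilon>"
    and nonneg: "\<And>t. 1 \<le> t \<Longrightarrow> t \<le> N \<Longrightarrow> 0 \<le> \<alpha> t" "\<And>t. t \<le> N \<Longrightarrow> 0 \<le> w t" "\<And>s. 0 \<le> p s"
    and w: "\<And>t. 1 \<le> t \<Longrightarrow> t \<le> N \<Longrightarrow>
        w t + 2 * l * (\<alpha> t)\<^sup>2 * G\<^sup>2 * (\<Sum>s=1..t. p s) * (w t)\<^sup>2 \<le> w (t - 1)"
  shows "prob {\<omega> \<in> space M. gap_sum \<alpha> w p x1 N \<omega> < ln (1 / \<epsilon>) / l} \<ge> 1 - \<epsilon>"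
proof -
  let ?g = "gap_sum \<alpha> w p x1 N" and ?b = "ln (1 / \<epsilon>) / l"
  have [measurable]: "?g \<in> borel_measurable M"
    using measurable_gap_sum_past[OF x1 order.refl] subalgebra_past[of N]
    by (auto simp: subalgebra_def measurable_def)
  have "emeasure M {\<omega> \<in> space M. ?g \<omega> \<ge> ?b} \<le>
      ennreal (exp (- l * ?b)) * (\<integral>\<^sup>+\<omega>. ennreal (exp (l * ?g \<omega>)) * indicator (space M) \<omega> \<partial>M)"
    using \<open>0 < l\<close> by (intro Chernoff_ineq_nn_integral_ge) auto
  also have "(\<integral>\<^sup>+\<omega>. ennreal (exp (l * ?g \<omega>)) * indicator (space M) \<omega> \<partial>M)
      \<le> (\<integral>\<^sup>+\<omega>. exp (l * (w N * (\<Sum>s=1..N. p s *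
              (norm (iterate \<alpha> x1 (Suc N) \<omega> - iterate \<alpha> x1 s \<omega>))\<^sup>2) + ?g \<omega>)) \<partial>M)"
    using nonneg \<open>0 < l\<close>
    by (intro nn_integral_mono) (auto simp: indicator_def intro!: ennreal_leI mult_nonneg_nonneg sum_nonneg)
  also have "\<dots> \<le> 1"
    using \<open>0 < l\<close> by (intro potential_exp_moment[OF x1 _ nonneg w]) auto
  also have "ennreal (exp (- l * ?b)) * 1 = ennreal \<epsilon>"
    using \<open>0 < l\<close> \<open>0 < \<epsilon>\<close> by (simp add: ln_div)
  finally have "emeasure M {\<omega> \<in> space M. ?g \<omega> \<ge> ?b} \<le> ennreal \<epsilon>"
    by (simp add: mult_left_mono)
  then have "prob {\<omega> \<in> space M. ?g \<omega> \<ge> ?b} \<le> \<epsilon>"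
    using \<open>0 < \<epsilon>\<close> by (simp add: emeasure_eq_measure)
  moreover have "prob {\<omega> \<in> space M. ?g \<omega> < ?b} = 1 - prob {\<omega> \<in> space M. ?g \<omega> \<ge> ?b}"
    by (subst prob_compl[symmetric]) (auto intro!: arg_cong[where f = prob])
  ultimately show ?thesis by simp
qed

text \<open>
  The weights \<open>w\<close> decrease linearly from \<open>1\<close> to \<open>1/2\<close>, by \<open>1 / (2 T)\<close> in each step,
  which suffices because the error terms are bounded by \<open>B / T\<close> uniformly in time. The step
  weights \<open>a\<close> contain \<open>w\<close>, so the reference mass has to be formed with \<open>a\<close> instead of \<open>\<alpha>\<close>.
\<close>

lemma last_iterate_high_probability:
  fixes \<alpha> q :: "nat \<Rightarrow> real" and B :: real
  assumes x1: "x1 \<in> W" and G: "0 < G" and "0 < B" "0 < \<epsilon>" "0 < T"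
    and \<alpha>: "\<And>t. t \<in> {1..T} \<Longrightarrow> 0 < \<alpha> t"
    and q: "\<And>s. 0 \<le> q s" "(\<Sum>s=1..<T. q s) = 1"
  defines "w \<equiv> \<lambda>t. 1 - real t / (2 * real T)"
  defines "a \<equiv> \<lambda>t. w t * \<alpha> t"
  assumes P: "\<And>t. t \<in> {1..T} \<Longrightarrow> (\<alpha> t)\<^sup>2 * reference_mass a q T t \<le> B / T"
  shows "prob {\<omega> \<in> space M. F (iterate \<alpha> x1 T \<omega>) \<le> G\<^sup>2 * B * (1 / 2 + 2 * ln (1 / \<epsilon>))
           + (\<Sum>s=1..<T. q s * F (iterate \<alpha> x1 s \<omega>))} \<ge> 1 - \<epsilon>"
proof -
  have w: "1 / 2 \<le> w t" "w t \<le> 1" if "t \<le> T" for t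
    using that \<open>0 < T\<close> by (auto simp: w_def field_simps)
  have a: "0 < a t" if "t \<in> {1..T}" for t
    unfolding a_def using w[of t] \<alpha>[OF that] that by (intro mult_pos_pos) auto
  have a_apply: "a t = w t * \<alpha> t" for t by (simp add: a_def)
  define p where "p = reference_weight a q T"
  have p: "0 \<le> p s" for s unfolding p_def using a q \<open>0 < T\<close> by (intro reference_weight_nonneg)
  have sum_p: "(\<Sum>s=1..t. p s) = reference_mass a q T t" for t
    unfolding p_def by (rule sum_reference_weight)
  have P_nonneg: "0 \<le> reference_mass a q T t" for t
    unfolding sum_p[symmetric] using p by (intro sum_nonneg) auto
  \<comment> \<open>The largest exponent for which the decrease of \<open>w\<close> pays for the noise.\<close>
  define l where "l = 1 / (4 * G\<^sup>2 * B)"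
  have l: "0 < l" using G \<open>0 < B\<close> by (simp add: l_def)
  have step: "w t + 2 * l * (\<alpha> t)\<^sup>2 * G\<^sup>2 * (\<Sum>s=1..t. p s) * (w t)\<^sup>2 \<le> w (t - 1)"
    if t: "1 \<le> t" "t \<le> T" for t
  proof -
    have "2 * l * (\<alpha> t)\<^sup>2 * G\<^sup>2 * reference_mass a q T t * (w t)\<^sup>2
        = (2 * l * G\<^sup>2) * ((\<alpha> t)\<^sup>2 * reference_mass a q T t * (w t)\<^sup>2)" by (simp add: ac_simps)
    also have "\<dots> \<le> (2 * l * G\<^sup>2) * (B / T * 1\<^sup>2)"
      using t P[of t] w[of t] l P_nonneg \<open>0 < B\<close>
      by (intro mult_left_mono mult_mono power_mono) auto
    also have "\<dots> = 1 / (2 * T)" using G \<open>0 < B\<close> \<open>0 < T\<close> by (simp add: l_def field_simps)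
    also have "\<dots> = w (t - 1) - w t" using t \<open>0 < T\<close> by (simp add: w_def of_nat_diff field_simps)
    finally show ?thesis unfolding sum_p by simp
  qed
  let ?gap = "\<lambda>\<omega>. F (iterate \<alpha> x1 T \<omega>) - (\<Sum>s=1..<T. q s * F (iterate \<alpha> x1 s \<omega>))"
  have gap: "2 * ?gap \<omega> - G\<^sup>2 * B \<le> gap_sum \<alpha> w p x1 T \<omega>" for \<omega>
  proof -
    let ?F = "\<lambda>t. F (iterate \<alpha> x1 t \<omega>)"
    let ?P = "reference_mass a q T"
    have "gap_sum \<alpha> w p x1 T \<omega> =
        2 * (\<Sum>t=1..T. a t * (?P t * ?F t - (\<Sum>s=1..t. p s * ?F s)))
        - (\<Sum>t=1..T. w t * (\<alpha> t)\<^sup>2 * G\<^sup>2 * ?P t)"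
      unfolding gap_sum_def sum_p sum_subtractf sum_distrib_left[of 2]
      by (intro arg_cong2[where f = "(-)"] sum.cong refl) (simp only: a_apply mult.assoc)
    also have "(\<Sum>t=1..T. a t * (?P t * ?F t - (\<Sum>s=1..t. p s * ?F s))) = ?gap \<omega>"
      unfolding p_def by (rule last_iterate_identity[OF a \<open>0 < T\<close> q(2)])
    finally have eq: "gap_sum \<alpha> w p x1 T \<omega> = 2 * ?gap \<omega> - (\<Sum>t=1..T. w t * (\<alpha> t)\<^sup>2 * G\<^sup>2 * ?P t)" .
    have "(\<Sum>t=1..T. w t * (\<alpha> t)\<^sup>2 * G\<^sup>2 * ?P t) \<le> (\<Sum>t=1..T. G\<^sup>2 * (B / T))"
    proof (rule sum_mono)
      fix t assume t: "t \<in> {1..T}"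
      have "w t * (\<alpha> t)\<^sup>2 * G\<^sup>2 * ?P t = G\<^sup>2 * (w t * ((\<alpha> t)\<^sup>2 * ?P t))" by (simp add: ac_simps)
      also have "\<dots> \<le> G\<^sup>2 * (1 * (B / T))"
        using t P[OF t] w[of t] P_nonneg by (intro mult_left_mono mult_mono) auto
      finally show "w t * (\<alpha> t)\<^sup>2 * G\<^sup>2 * ?P t \<le> G\<^sup>2 * (B / T)" by simp
    qed
    also have "\<dots> = G\<^sup>2 * B" using \<open>0 < T\<close> by simp
    finally show ?thesis unfolding eq by simp
  qed
  define f where "f t \<omega> = F (iterate \<alpha> x1 t \<omega>)" for t \<omega>
  have f: "f t \<in> borel_measurable M" for t
    unfolding f_def by (rule measurable_compose[OF measurable_iterate_M[OF x1] measurable_F])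
  let ?b = "G\<^sup>2 * B * (1 / 2 + 2 * ln (1 / \<epsilon>))"
  have "1 - \<epsilon> \<le> prob {\<omega> \<in> space M. gap_sum \<alpha> w p x1 T \<omega> < ln (1 / \<epsilon>) / l}"
  proof (rule gap_sum_tail_bound[OF x1 l \<open>0 < \<epsilon>\<close> _ _ p step])
    show "0 \<le> \<alpha> t" if "1 \<le> t" "t \<le> T" for t using \<alpha>[of t] that by simp
    show "0 \<le> w t" if "t \<le> T" for t using w(1)[OF that] by simp
  qed
  also have "\<dots> \<le> prob {\<omega> \<in> space M. f T \<omega> \<le> ?b + (\<Sum>s=1..<T. q s * f s \<omega>)}"
  proof (rule finite_measure_mono)
    have "f T \<omega> \<le> ?b + (\<Sum>s=1..<T. q s * f s \<omega>)"
      if "gap_sum \<alpha> w p x1 T \<omega> < ln (1 / \<epsilon>) / l" for \<omega>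
    proof -
      have "2 * ?gap \<omega> \<le> G\<^sup>2 * B + ln (1 / \<epsilon>) / l" using gap[of \<omega>] that by linarith
      also have "ln (1 / \<epsilon>) / l = G\<^sup>2 * B * (4 * ln (1 / \<epsilon>))" by (simp add: l_def ac_simps)
      also have "G\<^sup>2 * B + \<dots> = 2 * ?b" by (simp only: distrib_left)
      finally have "?gap \<omega> \<le> ?b" by (rule mult_left_le_imp_le) simp
      then show ?thesis unfolding f_def diff_le_eq .
    qed
    then show "{\<omega> \<in> space M. gap_sum \<alpha> w p x1 T \<omega> < ln (1 / \<epsilon>) / l}
      \<subseteq> {\<omega> \<in> space M. f T \<omega> \<le> ?b + (\<Sum>s=1..<T. q s * f s \<omega>)}" by blast
    show "{\<omega> \<in> space M. f T \<omega> \<le> ?b + (\<Sum>s=1..<T. q s * f s \<omega>)} \<in> events"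
      by (intro borel_measurable_le borel_measurable_add borel_measurable_sum
          borel_measurable_times borel_measurable_const f)
  qed
  finally show ?thesis unfolding f_def .
qed

end

section \<open>The high-probability bound for phased step sizes\<close>

lemma sgd_cong:
  assumes "\<And>r. \<lbrakk>1 \<le> r; r < n\<rbrakk> \<Longrightarrow> a r = b r"
  shows "sgd W a h x1 n = sgd W b h x1 n"
  using assms
proof (induction n)
  case (Suc n)
  then show ?case by (cases n) auto
qed simp

lemma sgd_constant:
  assumes "x1 \<in> W" "\<And>r. \<lbrakk>1 \<le> r; r < n\<rbrakk> \<Longrightarrow> a r *\<^sub>R h r x1 = 0"
  shows "sgd W a h x1 n = x1"
  using assms(2)
proof (induction n)
  case (Suc n)
  show ?case
  proof (cases n)
    case (Suc m)
    then have "a n *\<^sub>R h n x1 = 0" by (intro Suc.prems) auto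
    then have "closest_point W (x1 - a n *\<^sub>R h n x1) = x1"
      by (metis assms(1) closest_point_self diff_zero)
    moreover have "sgd W a h x1 n = x1" by (intro Suc.IH Suc.prems) auto
    ultimately show ?thesis using Suc by simp
  qed simp
qed simp

theorem theorem4:
  fixes M :: "'w measure"
    and W :: "'a::euclidean_space set"
    and F :: "'a \<Rightarrow> real"
    and xstar x1 :: 'a
    and g :: "nat \<Rightarrow> 'a \<Rightarrow> 'a"
    and ghat :: "nat \<Rightarrow> 'w \<Rightarrow> 'a \<Rightarrow> 'a"
    and G \<beta> \<delta> :: real
    and \<gamma> \<alpha> :: "nat \<Rightarrow> real"
    and T :: nat
    and x y :: "nat \<Rightarrow> 'w \<Rightarrow> 'a"
    and q :: "nat pmf"
  assumes "prob_space M"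
    and "closed W" and "convex W"
    and "convex_on UNIV F"
    and "xstar \<in> W" and "\<forall>z. F xstar \<le> F z"
    and "stochastic_subgradient_oracle M W F g ghat"
    and "G_Lipschitz M W F ghat G"
    and "decreasing_steps \<gamma>"
    and "poly_decay \<beta> \<gamma>"
    and "T \<ge> 4"
    and "x1 \<in> W"
    and "\<And>t \<omega>. y t \<omega> = sgd W \<gamma> (\<lambda>s. ghat s \<omega>) x1 t"
    and "\<And>i t. \<lbrakk>i \<le> last_phase T; phase_time T i < t; t \<le> phase_time T (i + 1)\<rbrakk>
                  \<Longrightarrow> \<alpha> t = \<gamma> t / 2 ^ i"
    and "\<And>t \<omega>. x t \<omega> = sgd W \<alpha> (\<lambda>s. ghat s \<omega>) x1 t"
    and "set_pmf q \<subseteq> {nat \<lceil>real T / 4\<rceil>..phase_time T 1}"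
    and "0 < \<delta>" and "\<delta> < 1"
  shows "\<P>(\<omega> in M. F (x T \<omega>) \<le>
            \<gamma> T * G\<^sup>2 * (120 * ln (1 / \<delta>) + 400) * (1 / \<beta>^2 + 1 / \<beta>^4)
            + (\<Sum>s = nat \<lceil>real T / 4\<rceil>..phase_time T 1. pmf q s * F (y s \<omega>)))
         \<ge> 1 - \<delta> / 2"
proof -
  interpret prob_space M by fact
  from assms(7) obtain A where A: "\<And>t. 1 \<le> t \<Longrightarrow> subalgebra M (A t)"
      "\<And>t. 1 \<le> t \<Longrightarrow> (\<lambda>(\<omega>, z). ghat t \<omega> z) \<in> borel_measurable (A t \<Otimes>\<^sub>M restrict_space borel W)"
      "indep_sets (\<lambda>t. sets (A t)) {1..}"
    unfolding stochastic_subgradient_oracle_def indep_random_maps_def by auto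
  interpret bounded_subgradient_oracle M A W F ghat G
    using A assms(7,8)
    by unfold_locales
       (auto simp: assms stochastic_subgradient_oracle_def G_Lipschitz_def intro: assms)
  have "x t = iterate \<alpha> x1 t" "y t = iterate \<gamma> x1 t" for t
    using assms(13,15) by blast+
  then have F_xy: "(\<lambda>\<omega>. F (x t \<omega>)) \<in> borel_measurable M" "(\<lambda>\<omega>. F (y t \<omega>)) \<in> borel_measurable M" for t
    using measurable_compose[OF measurable_iterate_M[OF \<open>x1 \<in> W\<close>] measurable_F] by simp_all

  define n where "n = nat \<lceil>real T / 4\<rceil>"
  let ?I = "{n..phase_time T 1}"
  have n: "1 \<le> n" "\<And>t. n \<le> t \<Longrightarrow> T \<le> 4 * t"
    using \<open>T \<ge> 4\<close> by (auto simp: n_def) linarith+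
  have T1: "phase_time T 1 < T"
    using last_phase_bounds(1)[of T] \<open>T \<ge> 4\<close> by (simp add: phase_time_def Suc_le_eq)
  have I: "?I \<subseteq> {1..<T}" using n T1 by auto
  have q0: "pmf q s = 0" if "s \<notin> ?I" for s
    using assms(16) that unfolding n_def by (auto simp: set_pmf_eq)
  have sum_I: "(\<Sum>s\<in>?I. pmf q s * f s) = (\<Sum>s=1..<T. pmf q s * f s)" for f
    using I q0 by (intro sum.mono_neutral_left) auto
  have q1: "(\<Sum>s=1..<T. pmf q s) = 1"
    using sum_I[of "\<lambda>_. 1"] sum_pmf_eq_1[of ?I q] assms(16) by (simp add: n_def)

  have xy: "x s \<omega> = y s \<omega>" if "s \<in> ?I" for s \<omega>
    unfolding assms(13,15)
  proof (rule sgd_cong)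
    fix r assume "1 \<le> r" "r < s"
    then show "\<alpha> r = \<gamma> r"
      using assms(14)[of 0 r] that by (simp add: phase_time_def)
  qed
  define E where "E = {\<omega> \<in> space M. F (x T \<omega>) \<le>
      \<gamma> T * G\<^sup>2 * (120 * ln (1 / \<delta>) + 400) * (1 / \<beta>^2 + 1 / \<beta>^4) + (\<Sum>s\<in>?I. pmf q s * F (y s \<omega>))}"
  have E_sets: "E \<in> sets M" 
    unfolding E_def
    by (intro borel_measurable_le borel_measurable_add borel_measurable_sum
        borel_measurable_times borel_measurable_const F_xy)
  have sum_y: "(\<Sum>s\<in>?I. pmf q s * F (y s \<omega>)) = (\<Sum>s=1..<T. pmf q s * F (x s \<omega>))" for \<omega>
    unfolding sum_I[symmetric] by (intro sum.cong) (auto simp: xy)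
  have G: "0 \<le> G" using norm_bound_nonneg[OF \<open>x1 \<in> W\<close>] .
  have \<gamma>: "0 \<le> \<gamma> T" using assms(9) \<open>T \<ge> 4\<close> by (auto simp: decreasing_steps_def)
  have "prob E \<ge> 1 - \<delta> / 2"
  proof (cases "G = 0 \<or> \<gamma> T = 0")
    \<comment> \<open>The exponent of the Chernoff bound would be infinite here, but the iterates almost surely do not move.\<close>
    case True
    have "AE \<omega> in M. \<forall>t\<in>{1..<T}. \<alpha> t *\<^sub>R ghat t \<omega> x1 = 0"
    proof (cases "G = 0")
      case True
      have "AE \<omega> in M. ghat t \<omega> x1 = 0" if "1 \<le> t" for t
        using norm_le_AE[OF that \<open>x1 \<in> W\<close>] True by simp
      then show ?thesis by (intro AE_finite_allI) auto
    next
      case False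
      have "\<alpha> t = 0" if t: "1 \<le> t" "t < T" for t
      proof -
        obtain i where "i \<le> last_phase T" "phase_time T i < t" "t \<le> phase_time T (i + 1)"
          using t by (rule phase_of_time)
        then have "\<alpha> t = \<gamma> t / 2 ^ i" by (rule assms(14))
        then show ?thesis
          using poly_decay_zero[OF assms(9,10) _ _ t(1), of T] False True \<open>T \<ge> 4\<close> by simp
      qed
      then show ?thesis by simp
    qed
    then have "AE \<omega> in M. \<omega> \<in> E"
      using AE_space
    proof eventually_elim
      case (elim \<omega>)
      then have "x t \<omega> = x1" if "t \<le> T" for t
        unfolding assms(15) using that by (intro sgd_constant \<open>x1 \<in> W\<close>) auto
      then have "(\<Sum>s=1..<T. pmf q s * F (x s \<omega>)) = (\<Sum>s=1..<T. pmf q s) * F (x T \<omega>)"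
        unfolding sum_distrib_right by (intro sum.cong) auto
      then show ?case using True elim unfolding E_def sum_y q1 by auto
    qed
    then have "prob E = 1" using E_sets by (simp add: prob_eq_1)
    then show ?thesis using \<open>0 < \<delta>\<close> by simp
  next
    case False
    then have pos: "0 < G" "0 < \<gamma> T" using G \<gamma> by auto
    have \<beta>: "0 < \<beta>" "\<beta> \<le> 1" using assms(10) by (auto simp: poly_decay_def)
    have T: "2 \<le> T" using \<open>T \<ge> 4\<close> by simp
    note bounds = halving_schedule_bounds[where \<alpha> = \<alpha>, OF T assms(9,10,14)]
    define w where "w = (\<lambda>t. 1 - real t / (2 * real T))"
    define C where "C = \<gamma> T / \<beta>\<^sup>2"
    have C: "\<gamma> T \<le> C"
      using \<beta> pos power_le_one[of \<beta> 2] by (simp add: C_def field_simps)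
    \<comment> \<open>This is \<open>22 * C^2 / \<gamma> T\<close>, the constant of \<open>linear_decay_reference_mass\<close>.\<close>
    define B where "B = 22 * \<gamma> T / \<beta> ^ 4"
    have B: "0 < B" using pos \<beta> by (simp add: B_def)
    have \<alpha>_pos: "0 < \<alpha> t" if t: "t \<in> {1..T}" for t
    proof (cases "t = T")
      case True
      have "0 < \<gamma> T / (2 * real T)" using pos T by simp
      then show ?thesis unfolding True using bounds(3) by linarith
    next
      case False
      then have "0 < \<gamma> T * real (T - t) / T" using pos t by simp
      moreover have "\<gamma> T * real (T - t) / T \<le> \<alpha> t" using bounds(1) t False by simp
      ultimately show ?thesis by linarith
    qed
    have P: "(\<alpha> t)\<^sup>2 * reference_mass (\<lambda>t. w t * \<alpha> t) (pmf q) T t \<le> B / T" if t: "t \<in> {1..T}" for t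
    proof -
      have "(\<alpha> t)\<^sup>2 * reference_mass (\<lambda>t. w t * \<alpha> t) (pmf q) T t \<le> 22 * C\<^sup>2 / (\<gamma> T * T)"
      proof (rule linear_decay_reference_mass[where \<alpha> = \<alpha> and w = w and q = "pmf q" and start = n])
        show "1 / 2 \<le> w t" if "t \<le> T" for t using that T by (simp add: w_def field_simps)
        show "\<alpha> t \<le> 2 * C * real (T - t) / T" if "1 \<le> t" "t < T" "n \<le> t" for t
          unfolding C_def using bounds(2) n that by simp
      qed (use pos C T t bounds q0 q1 in auto)
      also have "\<dots> = B / T"
        using pos by (simp add: C_def B_def power_divide power2_eq_square power4_eq_xxxx)
      finally show ?thesis .
    qed
    have "1 - \<delta> / 2 \<le> prob {\<omega> \<in> space M. F (iterate \<alpha> x1 T \<omega>) \<le>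
        G\<^sup>2 * B * (1 / 2 + 2 * ln (1 / (\<delta> / 2))) + (\<Sum>s=1..<T. pmf q s * F (iterate \<alpha> x1 s \<omega>))}"
    proof (rule last_iterate_high_probability[where \<alpha> = \<alpha> and q = "pmf q" and B = B])
      show "(\<alpha> t)\<^sup>2 * reference_mass (\<lambda>t. (1 - real t / (2 * real T)) * \<alpha> t) (pmf q) T t \<le> B / T"
        if "t \<in> {1..T}" for t using P[OF that] unfolding w_def .
    qed (use \<open>x1 \<in> W\<close> pos B \<open>0 < \<delta>\<close> T \<alpha>_pos q1 in auto)
    also have "\<dots> \<le> prob E"
    proof (intro finite_measure_mono E_sets subsetI)
      fix \<omega> assume \<omega>: "\<omega> \<in> {\<omega> \<in> space M. F (iterate \<alpha> x1 T \<omega>) \<le>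
        G\<^sup>2 * B * (1 / 2 + 2 * ln (1 / (\<delta> / 2))) + (\<Sum>s=1..<T. pmf q s * F (iterate \<alpha> x1 s \<omega>))}"
      have ln\<delta>: "0 \<le> ln (1 / \<delta>)" using \<open>0 < \<delta>\<close> \<open>\<delta> < 1\<close> by simp
      \<comment> \<open>The constants \<open>44\<close> and \<open>55\<close> obtained here are below the ones claimed.\<close>
      have "ln (1 / (\<delta> / 2)) = ln 2 + ln (1 / \<delta>)" using \<open>0 < \<delta>\<close> by (simp add: ln_div)
      also have "\<dots> \<le> 1 + ln (1 / \<delta>)" using ln_2_less_1 by simp
      finally have "G\<^sup>2 * B * (1 / 2 + 2 * ln (1 / (\<delta> / 2))) \<le> G\<^sup>2 * B * (5 / 2 + 2 * ln (1 / \<delta>))"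
        using B by (intro mult_left_mono) auto
      also have "\<dots> = \<gamma> T * G\<^sup>2 * (44 * ln (1 / \<delta>) + 55) * (1 / \<beta> ^ 4)"
        using \<beta>(1) by (simp add: B_def field_simps)
      also have "\<dots> \<le> \<gamma> T * G\<^sup>2 * (120 * ln (1 / \<delta>) + 400) * (1 / \<beta>^2 + 1 / \<beta> ^ 4)"
        using pos \<beta> ln\<delta> by (intro mult_mono) auto
      finally show "\<omega> \<in> E" using \<omega> unfolding E_def sum_y assms(15) by simp
    qed
    finally show ?thesis .
  qed
  then show ?thesis unfolding E_def n_def .
qed

end
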